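(* For $\alpha\in\mathbb{R}$ let $C_\alpha=\alpha\,\mathrm{Id}$, where $\mathrm{Id}$ denotes the $M\times M$ identity matrix. Then the following hold. (i) For every $M\in\mathbb{N}$, $\sigma^2>0$, $1\le r\le M$ and every $\alpha\neq 0$, $$\delta_{C_\alpha,M,\sigma^2,r}\ \ge\ \delta_{0,M,\sigma^2,r}.$$ (ii) There exists a constant $c_1>0$, independent of $\sigma^2$, $r$ and $M$, such that $$\liminf_{|\alpha|\to\infty}\frac{\delta_{C_\alpha,M,\sigma^2,r}}{|\alpha|}\ \ge\ c_1\,\sigma\, r\sqrt{M-r}\qquad\text{for all } r\le M-r.$$
   Context: Let $M\in\mathbb{N}$, $\sigma^2>0$ (with $\sigma>0$), and let $\mathrm{E}$ be a random $M\times M$ real matrix whose entries are independent centered Gaussian random variables with variance $\sigma^2$. For $1\le r\le M$, $\mathcal{S}_{M,r}\subset\mathbb{R}^{M\times M}$ is the set of all matrices of orthogonal projections onto $r$-dimensional linear subspaces of $\mathbb{R}^M$. $\|\cdot\|_{S_2}$ is the Hilbert-Schmidt (Frobenius) norm. For a deterministic matrix $C\in\mathbb{R}^{M\times M}$ put $X=C+\mathrm{E}$, let $\hat\pi_r$ be a maximizer of $\tilde\pi_r\mapsto\|\tilde\pi_rX\|_{S_2}^2$ over $\mathcal{S}_{M,r}$, and let $\pi_r$ be a (deterministic) maximizer of $\tilde\pi_r\mapsto\mathbf{E}\|\tilde\pi_rX\|_{S_2}^2$ over $\mathcal{S}_{M,r}$ (equivalently, of $\|\tilde\pi_rC\|_{S_2}^2$).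 Define $$\delta_{C,M,\sigma^2,r}:=\mathbf{E}\|\hat\pi_rX\|_{S_2}^2-\mathbf{E}\|\pi_rX\|_{S_2}^2=\sum_{i=1}^r\mathbf{E}\big(\hat\lambda_i^2-\lambda_i^2-\sigma^2M\big),$$ where $\hat\lambda_1\ge\dots\ge\hat\lambda_M$ and $\lambda_1\ge\dots\ge\lambda_M$ are the singular values of $X$ and $C$. $\delta_{0,M,\sigma^2,r}$ is the case $C=0$. *)

theory Defs
  imports "HOL-Probability.Probability" "Jordan_Normal_Form.VS_Connect"
begin

text \<open>
  The dimension \<open>M\<close> is quantified inside the theorem (the constant in the lower bound must not
  depend on it), so matrices are the dimension-free \<open>real mat\<close> with explicit carriers.
\<close>

definition hs_norm :: "real mat \<Rightarrow> real" where
  "hs_norm A = sqrt (\<Sum>i<dim_row A. \<Sum>j<dim_col A. (A $$ (i, j))\<^sup>2)"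

text \<open>\<open>p\<close> is the matrix of the orthogonal projection onto \<open>V\<close>: every \<open>x\<close> splits as
  \<open>p x \<in> V\<close> plus a remainder orthogonal to \<open>V\<close>.\<close>

definition is_orth_proj_onto :: "nat \<Rightarrow> real vec set \<Rightarrow> real mat \<Rightarrow> bool" where
  "is_orth_proj_onto M V p \<longleftrightarrow>
     p \<in> carrier_mat M M \<and>
     (\<forall>x\<in>carrier_vec M. p *\<^sub>v x \<in> V \<and> (\<forall>v\<in>V. scalar_prod (x - p *\<^sub>v x) v = 0))"

definition orth_projs :: "nat \<Rightarrow> nat \<Rightarrow> real mat set" where
  "orth_projs M r =
     {p. \<exists>V. VectorSpace.subspace class_ring V (module_vec TYPE(real) M) \<and>
             vectorspace.dim class_ring ((module_vec TYPE(real) M)\<lparr>carrier := V\<rparr>) = r \<and>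
             is_orth_proj_onto M V p}"

text \<open>\<open>normal_density\<close> takes the standard deviation \<open>\<sigma>\<close>, so the entries have variance \<open>\<sigma>\<^sup>2\<close>.\<close>

definition gaussian_matrix :: "'a measure \<Rightarrow> nat \<Rightarrow> real \<Rightarrow> ('a \<Rightarrow> real mat) \<Rightarrow> bool" where
  "gaussian_matrix P M \<sigma> E \<longleftrightarrow>
     prob_space P \<and>
     (\<forall>\<omega>\<in>space P. E \<omega> \<in> carrier_mat M M) \<and>
     prob_space.indep_vars P (\<lambda>_. borel) (\<lambda>ij \<omega>. E \<omega> $$ ij) ({..<M} \<times> {..<M}) \<and>
     (\<forall>i<M. \<forall>j<M. distributed P lborel (\<lambda>\<omega>. E \<omega> $$ (i, j)) (normal_density 0 \<sigma>))"

text \<open>Maximizers need not be unique; \<open>arg_max_on\<close> selects one. Neither term of \<open>excess\<close> below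
  depends on the selection, since only the maximal values enter.\<close>

definition pi_hat :: "nat \<Rightarrow> nat \<Rightarrow> real mat \<Rightarrow> real mat" where
  "pi_hat M r X = arg_max_on (\<lambda>p. (hs_norm (p * X))\<^sup>2) (orth_projs M r)"

definition pi_det :: "'a measure \<Rightarrow> nat \<Rightarrow> nat \<Rightarrow> ('a \<Rightarrow> real mat) \<Rightarrow> real mat" where
  "pi_det P M r X = arg_max_on (\<lambda>p. \<integral>\<omega>. (hs_norm (p * X \<omega>))\<^sup>2 \<partial>P) (orth_projs M r)"

text \<open>The quantity \<open>\<delta>\<close> for \<open>X = C + E\<close>; the variance enters through the noise \<open>E\<close>.\<close>

definition excess :: "'a measure \<Rightarrow> ('a \<Rightarrow> real mat) \<Rightarrow> nat \<Rightarrow> nat \<Rightarrow> real mat \<Rightarrow> real" where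
  "excess P E M r C =
     (let X = (\<lambda>\<omega>. C + E \<omega>) in
        (\<integral>\<omega>. (hs_norm (pi_hat M r (X \<omega>) * X \<omega>))\<^sup>2 \<partial>P)
      - (\<integral>\<omega>. (hs_norm (pi_det P M r X * X \<omega>))\<^sup>2 \<partial>P))"

end

theory Submission
  imports Defs "Jordan_Normal_Form.DL_Rank"
begin

text \<open>
  For an orthogonal projection \<open>p\<close> of rank \<open>r\<close>,
  \<open>|p (a + E)|\<^sup>2 = a\<^sup>2 r + 2 a tr (p E) + |p E|\<^sup>2\<close>. The expectation of the right-hand side is
  \<open>a\<^sup>2 r + \<sigma>\<^sup>2 M r\<close> for every \<open>p\<close>, so the excess at \<open>a\<close> is the expectation of
  \<open>max\<^sub>p (2 a tr (p E) + |p E|\<^sup>2)\<close> minus \<open>\<sigma>\<^sup>2 M r\<close> (lemma \<open>excess_eq\<close>). Everything else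
  rests on the fact that the law of \<open>E\<close> is invariant under changing the signs of entries
  (\<open>integral_sign_change\<close>). Averaging over a sign change is a device for choosing \<open>p\<close> depending on \<open>E\<close>
  pointwise: the inequality between maxima holds for each realization, and no measurable choice of
  a maximizer is involved.

  For the first part, use the signs \<open>E\<close> and \<open>- E\<close>. A projection that maximizes \<open>|p E|\<^sup>2\<close> competes in both
  maxima, and the linear terms cancel (\<open>max_energy_reflection\<close>).

  For the second part, let \<open>m = M - r\<close> and let \<open>B\<close> be the upper right \<open>r \<times> m\<close> block of \<open>E\<close>. Reverse the
  signs of all entries outside \<open>B\<close>. For the projection onto the row space of \<open>[1, Q]\<close>, where \<open>Q\<close> has
  orthonormal rows, the two linear terms add up to \<open>2 a tr (Q B\<^sup>T)\<close> (\<open>overlap_block_gain\<close>). The maximum of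
  \<open>tr (Q B\<^sup>T)\<close> over \<open>Q\<close> is the sum of the \<open>r\<close> singular values of \<open>B\<close>, which are typically of order
  \<open>\<sigma> sqrt m\<close>. To turn this into a bound for the expectation, each singular value \<open>s\<close> is estimated from
  below by \<open>3 s\<^sup>2 / (2 c) - s\<^sup>4 / (2 c\<^sup>3)\<close> with \<open>c\<close> of order \<open>\<sigma> sqrt m\<close> (\<open>frame_lower_bound\<close>); the sums of these
  powers are polynomials in the entries of \<open>B\<close>, of which only Gaussian moments up to order four are
  needed (\<open>block_gain_expectation\<close>). The result is an excess of at least
  \<open>3 / 8 |a| \<sigma> r sqrt m - \<sigma>\<^sup>2 M r\<close>, valid for every \<open>a\<close>.
\<close>

section \<open>Orthogonal projections as symmetric idempotents\<close>

lemma (in vec_space) subspace_basis_list: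
  assumes W: "subspace class_ring W V"
  obtains ws where "distinct ws" "set ws \<subseteq> W" "lin_indpt (set ws)" "span (set ws) = W"
    "length ws = vectorspace.dim class_ring (V\<lparr>carrier := W\<rparr>)"
proof -
  interpret w: vectorspace class_ring "V\<lparr>carrier := W\<rparr>"
    using subspace_is_vs[OF W] .
  have sm: "submodule class_ring W V" using W by (simp add: subspace_def)
  have Wc: "W \<subseteq> carrier_vec n" using submodule.subset[OF sm] by simp
  have small: "finite A \<and> card A \<le> dim" if "A \<subseteq> W" "w.lin_indpt A" for A
    using that Wc span_li_not_depend(2)[OF that(1) sm] li_le_dim[OF fin_dim, of A] by auto
  have "\<exists>A. finite A \<and> maximal A (\<lambda>S. S \<subseteq> carrier (V\<lparr>carrier := W\<rparr>) \<and> w.lin_indpt S)"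
    by (rule maximal_exists[where N = "dim" and B = "{}"])
       (use small in \<open>auto simp: w.lin_dep_def\<close>)
  then obtain A where A: "finite A" "w.basis A"
    using w.max_li_is_basis by blast
  have AW: "A \<subseteq> W" and li: "w.lin_indpt A" and sp: "w.span A = W"
    using A(2) by (auto simp: w.basis_def)
  obtain ws where ws: "set ws = A" "distinct ws" using finite_distinct_list[OF A(1)] by blast
  show thesis
  proof (rule that)
    show "length ws = vectorspace.dim class_ring (V\<lparr>carrier := W\<rparr>)"
      using w.dim_basis[OF A] ws distinct_card[of ws] by simp
    show "lin_indpt (set ws)" using li span_li_not_depend(2)[OF AW sm] ws by simp
    show "span (set ws) = W" using sp span_li_not_depend(1)[OF AW sm] ws by simp
  qed (use ws AW in auto)
qed

lemma scalar_prod_self_eq_0_real: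
  fixes v :: "real vec"
  assumes "scalar_prod v v = 0"
  shows "v = 0\<^sub>v (dim_vec v)"
proof -
  have "(\<Sum>i\<in>{0..<dim_vec v}. v $ i * v $ i) = 0"
    using assms by (simp add: scalar_prod_def)
  then have "\<forall>i\<in>{0..<dim_vec v}. v $ i * v $ i = 0"
    by (subst (asm) sum_nonneg_eq_0_iff) auto
  then show ?thesis by (intro eq_vecI) auto
qed

lemma mat_unit_vec_col:
  fixes A :: "real mat"
  assumes "A \<in> carrier_mat nr nc" "j < nc"
  shows "A *\<^sub>v unit_vec nc j = col A j"
  using assms by (intro eq_vecI) auto

context
  fixes M :: nat and W :: "real vec set" and p :: "real mat"
  assumes W: "VectorSpace.subspace class_ring W (module_vec TYPE(real) M)"
    and p: "is_orth_proj_onto M W p"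
begin

interpretation vec_space "TYPE(real)" M .

lemma orth_proj_carrier: "p \<in> carrier_mat M M"
  using p by (simp add: is_orth_proj_onto_def)

lemma orth_proj_in: "x \<in> carrier_vec M \<Longrightarrow> p *\<^sub>v x \<in> W"
  using p by (simp add: is_orth_proj_onto_def)

lemma orth_proj_orth: "x \<in> carrier_vec M \<Longrightarrow> v \<in> W \<Longrightarrow> scalar_prod (x - p *\<^sub>v x) v = 0"
  using p by (simp add: is_orth_proj_onto_def)

lemma orth_proj_submodule: "submodule class_ring W V" using W by (simp add: subspace_def)

lemma orth_proj_range_carrier: "v \<in> W \<Longrightarrow> v \<in> carrier_vec M"
  using submodule.subset[OF orth_proj_submodule] by auto

lemma orth_proj_fixes:
  assumes v: "v \<in> W"
  shows "p *\<^sub>v v = v"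
proof -
  have vc: "v \<in> carrier_vec M" using orth_proj_range_carrier[OF v] .
  have pv: "p *\<^sub>v v \<in> carrier_vec M" using orth_proj_range_carrier[OF orth_proj_in[OF vc]] .
  have "(-1) \<cdot>\<^sub>v (p *\<^sub>v v) \<in> W"
    using submodule.smult_closed[OF orth_proj_submodule, of "-1" "p *\<^sub>v v"] orth_proj_in[OF vc] by simp
  then have "v + (-1) \<cdot>\<^sub>v (p *\<^sub>v v) \<in> W"
    using submodule.m_closed[OF orth_proj_submodule v] by simp
  also have "v + (-1) \<cdot>\<^sub>v (p *\<^sub>v v) = v - p *\<^sub>v v"
    using vc pv by (intro eq_vecI) auto
  finally have "scalar_prod (v - p *\<^sub>v v) (v - p *\<^sub>v v) = 0"
    by (rule orth_proj_orth[OF vc])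
  from scalar_prod_self_eq_0_real[OF this] have z: "v - p *\<^sub>v v = 0\<^sub>v (dim_vec (v - p *\<^sub>v v))" .
  show ?thesis
  proof (rule eq_vecI)
    fix i assume "i < dim_vec v"
    then have "(v - p *\<^sub>v v) $ i = 0" using z pv vc by (metis carrier_vecD index_minus_vec(2) index_zero_vec(1))
    then show "(p *\<^sub>v v) $ i = v $ i" using \<open>i < dim_vec v\<close> carrier_vecD[OF pv] carrier_vecD[OF vc] by simp
  qed (use orth_proj_carrier vc in auto)
qed

lemma orth_proj_idem: "p * p = p"
proof (rule mat_col_eqI)
  fix j assume "j < dim_col p"
  then have j: "j < M" using orth_proj_carrier by auto
  have "col (p * p) j = p *\<^sub>v col p j"
    using j orth_proj_carrier by (intro col_mult2) auto
  also have "col p j = p *\<^sub>v unit_vec M j"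
    using j orth_proj_carrier by (simp add: mat_unit_vec_col[where nr = M])
  also have "p *\<^sub>v (p *\<^sub>v unit_vec M j) = p *\<^sub>v unit_vec M j"
    by (intro orth_proj_fixes orth_proj_in) auto
  finally show "col (p * p) j = col p j"
    using j orth_proj_carrier by (simp add: mat_unit_vec_col[where nr = M])
qed (use orth_proj_carrier in auto)

lemma orth_proj_sym: "p\<^sup>T = p"
proof (rule eq_matI)
  have *: "scalar_prod x (p *\<^sub>v y) = scalar_prod (p *\<^sub>v x) (p *\<^sub>v y)"
    if "x \<in> carrier_vec M" "y \<in> carrier_vec M" for x y
    using orth_proj_orth[OF that(1) orth_proj_in[OF that(2)]] that orth_proj_carrier
    by (subst (asm) minus_scalar_prod_distrib[where n = M]) auto
  have e: "p $$ (i, j) = scalar_prod (unit_vec M i) (p *\<^sub>v unit_vec M j)" if "i < M" "j < M" for i j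
    using that orth_proj_carrier by (simp add: mat_unit_vec_col[where nr = M])
  fix i j assume "i < dim_row p" "j < dim_col p"
  then have ij: "i < M" "j < M" using orth_proj_carrier by auto
  have "p $$ (j, i) = scalar_prod (p *\<^sub>v unit_vec M j) (p *\<^sub>v unit_vec M i)"
    using e[OF ij(2,1)] * by simp
  also have "\<dots> = scalar_prod (p *\<^sub>v unit_vec M i) (p *\<^sub>v unit_vec M j)"
    using orth_proj_carrier by (intro comm_scalar_prod[where n = M]) auto
  also have "\<dots> = p $$ (i, j)"
    using e[OF ij] * by simp
  finally show "p\<^sup>T $$ (i, j) = p $$ (i, j)"
    using ij orth_proj_carrier by simp
qed (use orth_proj_carrier in auto)

text \<open>Let the columns of \<open>B\<close> be a basis of \<open>W\<close>. The columns of \<open>p\<close> lie in \<open>W\<close>, so \<open>p = B A\<close>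
  for some \<open>A\<close>. As \<open>p\<close> fixes the columns of \<open>B\<close>, we get \<open>B A B = B\<close>, and injectivity of \<open>B\<close> gives
  \<open>A B = 1\<close>. Hence \<open>tr p = tr (B A) = tr (A B)\<close> is the number of basis vectors.\<close>

lemma orth_proj_trace:
  "(\<Sum>i<M. p $$ (i, i)) = real (vectorspace.dim class_ring (module_vec TYPE(real) M\<lparr>carrier := W\<rparr>))"
proof -
  obtain ws where d: "distinct ws" and wsW: "set ws \<subseteq> W" and li: "lin_indpt (set ws)"
    and sp: "span (set ws) = W"
    and len: "length ws = vectorspace.dim class_ring (V\<lparr>carrier := W\<rparr>)"
    using subspace_basis_list[OF W] by blast
  define k where "k = length ws"
  define B where "B = mat_of_cols M ws"
  have B: "B \<in> carrier_mat M k" by (simp add: B_def k_def)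
  have wsc: "set ws \<subseteq> carrier_vec M" using wsW orth_proj_range_carrier by auto
  have colsB: "cols B = ws" unfolding B_def using wsc by (rule cols_mat_of_cols)
  have sol: "\<exists>x\<in>carrier_vec k. B *\<^sub>v x = y" if "y \<in> W" for y
    using that sp col_space_eq[OF B] B colsB unfolding col_space_def by auto
  have colp: "col p j \<in> W" if "j < M" for j
    using that orth_proj_in[of "unit_vec M j"] orth_proj_carrier by (simp add: mat_unit_vec_col[where nr = M])
  obtain f where f: "\<And>j. j < M \<Longrightarrow> f j \<in> carrier_vec k \<and> B *\<^sub>v f j = col p j"
    using sol[OF colp] by metis
  define A where "A = mat_of_cols k (map f [0..<M])"
  have A: "A \<in> carrier_mat k M" by (simp add: A_def carrier_matI)
  have colA: "col A j = f j" if "j < M" for j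
    using that f by (simp add: A_def)
  have BA: "B * A = p"
  proof (rule mat_col_eqI)
    fix j assume "j < dim_col p"
    then have j: "j < M" using orth_proj_carrier by auto
    show "col (B * A) j = col p j"
      using col_mult2[OF B A j] colA[OF j] f[OF j] by simp
  qed (use A B orth_proj_carrier in auto)
  have inj: "v = 0\<^sub>v k" if "v \<in> carrier_vec k" "B *\<^sub>v v = 0\<^sub>v M" for v
    using lin_depI[OF B that(1) _ that(2)] li d by (auto simp: colsB)
  have AB: "A * B = 1\<^sub>m k"
  proof (rule mat_col_eqI)
    fix j assume "j < dim_col (1\<^sub>m k)"
    then have j: "j < k" by simp
    have cB: "col B j = ws ! j"
      unfolding B_def using j wsc by (intro col_mat_of_cols) (auto simp: k_def)
    have "B *\<^sub>v (A *\<^sub>v col B j) = p *\<^sub>v col B j"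
      using A B BA by (metis assoc_mult_mat_vec carrier_vecI col_dim carrier_matD(1))
    also have "\<dots> = col B j"
      using wsW j by (intro orth_proj_fixes) (auto simp: cB k_def)
    finally have 1: "B *\<^sub>v (A *\<^sub>v col B j) = B *\<^sub>v unit_vec k j"
      using B j by (simp add: mat_unit_vec_col[where nr = M])
    have c: "A *\<^sub>v col B j \<in> carrier_vec k" using A B by auto
    have "B *\<^sub>v (A *\<^sub>v col B j - unit_vec k j) = 0\<^sub>v M"
      using 1 B c by (subst mult_minus_distrib_mat_vec[OF B]) auto
    then have "A *\<^sub>v col B j - unit_vec k j = 0\<^sub>v k" using c by (intro inj) auto
    then have "A *\<^sub>v col B j = unit_vec k j"
      using c by (metis carrier_vecD eq_vecI index_minus_vec(1) index_unit_vec(3) index_zero_vec(1) right_minus_eq unit_vec_carrier)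
    then show "col (A * B) j = col (1\<^sub>m k) j"
      using col_mult2[OF A B j] j by simp
  qed (use A B in auto)
  have "(\<Sum>i<M. p $$ (i, i)) = (\<Sum>i<M. \<Sum>j<k. B $$ (i, j) * A $$ (j, i))"
    unfolding BA[symmetric] using A B
    by (intro sum.cong refl) (auto simp: scalar_prod_def atLeast0LessThan)
  also have "\<dots> = (\<Sum>j<k. \<Sum>i<M. A $$ (j, i) * B $$ (i, j))"
    by (subst sum.swap) (simp add: mult.commute)
  also have "\<dots> = (\<Sum>j<k. (A * B) $$ (j, j))"
    using A B by (intro sum.cong refl) (auto simp: scalar_prod_def atLeast0LessThan)
  also have "\<dots> = real k" by (simp add: AB)
  finally show ?thesis using len k_def by simp
qed

end

text \<open>This description by polynomial equations in the entries is what makes the set of projections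
  closed and bounded, so that maximizers exist.\<close>

lemma orth_projs_iff:
  "p \<in> orth_projs M r \<longleftrightarrow>
     p \<in> carrier_mat M M \<and> p\<^sup>T = p \<and> p * p = p \<and> (\<Sum>i<M. p $$ (i, i)) = real r"
    (is "?L \<longleftrightarrow> ?R")
proof
  assume ?L
  then obtain W where W: "VectorSpace.subspace class_ring W (module_vec TYPE(real) M)"
    and p: "is_orth_proj_onto M W p"
    and r: "vectorspace.dim class_ring (module_vec TYPE(real) M\<lparr>carrier := W\<rparr>) = r"
    by (auto simp: orth_projs_def)
  show ?R
    using orth_proj_carrier[OF W p] orth_proj_sym[OF W p] orth_proj_idem[OF W p]
      orth_proj_trace[OF W p] r by simp
next
  assume R: ?R
  then have pc: "p \<in> carrier_mat M M" and sym: "p\<^sup>T = p" and idem: "p * p = p" by auto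
  define W where "W = {p *\<^sub>v x |x. x \<in> carrier_vec M}"
  interpret vec_space "TYPE(real)" M .
  have W: "subspace class_ring W V"
    unfolding subspace_def
  proof
    show "vectorspace class_ring V" by (rule vectorspace_axioms)
    show "submodule class_ring W V"
    proof (unfold_locales, goal_cases)
      case 1 then show ?case using pc by (auto simp: W_def)
    next
      case (2 v w)
      then obtain x y where "x \<in> carrier_vec M" "v = p *\<^sub>v x" "y \<in> carrier_vec M" "w = p *\<^sub>v y"
        by (auto simp: W_def)
      then have "v + w = p *\<^sub>v (x + y)" "x + y \<in> carrier_vec M"
        using mult_add_distrib_mat_vec[OF pc] by auto
      then show ?case by (auto simp: W_def)
    next
      case 3
      have "0\<^sub>v M = p *\<^sub>v 0\<^sub>v M" using pc by (intro eq_vecI) auto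
      then show ?case by (auto simp: W_def)
    next
      case (4 c v)
      then obtain x where "x \<in> carrier_vec M" "v = p *\<^sub>v x" by (auto simp: W_def)
      then have "c \<cdot>\<^sub>v v = p *\<^sub>v (c \<cdot>\<^sub>v x)" "c \<cdot>\<^sub>v x \<in> carrier_vec M"
        using mult_mat_vec[OF pc] by auto
      then show ?case by (auto simp: W_def)
    qed
  qed
  have proj: "is_orth_proj_onto M W p"
    unfolding is_orth_proj_onto_def
  proof (intro conjI ballI)
    fix x v :: "real vec" assume x: "x \<in> carrier_vec M" and "v \<in> W"
    then obtain y where y: "y \<in> carrier_vec M" "v = p *\<^sub>v y" by (auto simp: W_def)
    have d: "x - p *\<^sub>v x \<in> carrier_vec M" using x pc by auto
    have "p *\<^sub>v (p *\<^sub>v x) = p *\<^sub>v x" using assoc_mult_mat_vec[OF pc pc x] idem by simp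
    then have z: "p *\<^sub>v (x - p *\<^sub>v x) = 0\<^sub>v M"
      using x pc by (subst mult_minus_distrib_mat_vec[OF pc]) auto
    have "scalar_prod (x - p *\<^sub>v x) (p *\<^sub>v y) = scalar_prod (p\<^sup>T *\<^sub>v (x - p *\<^sub>v x)) y"
      using transpose_vec_mult_scalar[OF pc y(1) d] by simp
    also have "\<dots> = 0" using z y sym by simp
    finally show "scalar_prod (x - p *\<^sub>v x) v = 0" using y by simp
  qed (use pc in \<open>auto simp: W_def\<close>)
  have "vectorspace.dim class_ring (V\<lparr>carrier := W\<rparr>) = r"
    using orth_proj_trace[OF W proj] R by simp
  then show ?L using W proj by (auto simp: orth_projs_def)
qed

section \<open>Polar decomposition and orthonormal frames\<close>

text \<open>Matrices are treated as functions of the index pair, which carry the product topology; by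
  Tychonoff's theorem a closed set of uniformly bounded functions is compact.\<close>

lemma compact_pointwise_bounded:
  fixes S :: "('i \<Rightarrow> real) set"
  assumes "closed S" "\<And>x i. x \<in> S \<Longrightarrow> \<bar>x i\<bar> \<le> b"
  shows "compact S"
proof -
  have "compactin (product_topology (\<lambda>i::'i. euclidean) UNIV) (PiE UNIV (\<lambda>_. {-b..b}))"
    by (subst compactin_PiE) auto
  then have c: "compact (PiE UNIV (\<lambda>_::'i. {-b..b}))"
    by (simp add: euclidean_product_topology)
  have "S \<subseteq> PiE UNIV (\<lambda>_. {-b..b})"
    using assms(2) by (auto simp: abs_le_iff minus_le_iff)
  then have "S = PiE UNIV (\<lambda>_::'i. {-b..b}) \<inter> S" by auto
  with compact_Int_closed[OF c assms(1)] show ?thesis by simp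
qed

text \<open>Orthogonal matrices, with the orthonormality imposed on the columns. The entries outside the
  index range are fixed to \<open>0\<close>, which keeps the set compact.\<close>

definition orth_funs :: "nat \<Rightarrow> (nat \<times> nat \<Rightarrow> real) set" where
  "orth_funs m = {Q. (\<forall>k<m. \<forall>l<m. (\<Sum>i<m. Q (i, k) * Q (i, l)) = of_bool (k = l)) \<and>
                     (\<forall>ij. ij \<notin> {..<m} \<times> {..<m} \<longrightarrow> Q ij = 0)}"

lemma compact_orth_funs: "compact (orth_funs m)"
proof (rule compact_pointwise_bounded[where b = 1])
  show "closed (orth_funs m)"
    unfolding orth_funs_def Collect_conj_eq imp_conv_disj
    by (intro closed_Int closed_Collect_all closed_Collect_disj closed_Collect_eq closed_Collect_const
          continuous_intros continuous_on_product_coordinates)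
  fix Q and ij :: "nat \<times> nat" assume Q: "Q \<in> orth_funs m"
  obtain i j where ij: "ij = (i, j)" by fastforce
  show "\<bar>Q ij\<bar> \<le> 1"
  proof (cases "i < m \<and> j < m")
    case True
    then have "(Q (i, j))\<^sup>2 \<le> (\<Sum>i<m. (Q (i, j))\<^sup>2)"
      by (intro member_le_sum) auto
    also have "\<dots> = 1" using Q True by (auto simp: orth_funs_def power2_eq_square)
    finally show ?thesis using ij by (simp add: abs_square_le_1)
  qed (use Q ij in \<open>auto simp: orth_funs_def\<close>)
qed

lemma id_in_orth_funs: "(\<lambda>(i, j). of_bool (i = j \<and> i < m)) \<in> orth_funs m"
  by (auto simp: orth_funs_def of_bool_def if_distrib sum.delta cong: if_cong)

text \<open>Left multiplication by the reflection \<open>1 - 2 u u\<^sup>T / |u|\<^sup>2\<close>. For \<open>u = 0\<close> the quotient is \<open>2 / 0 = 0\<close>,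
  which makes this the identity, so that no case distinction is needed for orthogonality.\<close>

definition reflect :: "nat \<Rightarrow> (nat \<Rightarrow> real) \<Rightarrow> (nat \<times> nat \<Rightarrow> real) \<Rightarrow> nat \<times> nat \<Rightarrow> real" where
  "reflect m u Q = (\<lambda>(i, k). if i < m \<and> k < m
     then Q (i, k) - 2 / (\<Sum>i<m. (u i)\<^sup>2) * u i * (\<Sum>l<m. u l * Q (l, k)) else 0)"

lemma reflect_orth_funs:
  assumes Q: "Q \<in> orth_funs m"
  shows "reflect m u Q \<in> orth_funs m"
proof -
  define c where "c = 2 / (\<Sum>i<m. (u i)\<^sup>2)"
  define w where "w k = (\<Sum>l<m. u l * Q (l, k))" for k
  have c: "c * (c * (\<Sum>i<m. (u i)\<^sup>2)) = 2 * c" by (simp add: c_def)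
  have h: "reflect m u Q (i, k) = Q (i, k) - c * u i * w k" if "i < m" "k < m" for i k
    using that by (simp add: reflect_def c_def w_def)
  have "(\<Sum>i<m. reflect m u Q (i, k) * reflect m u Q (i, l)) = of_bool (k = l)"
    if "k < m" "l < m" for k l
  proof -
    have "(\<Sum>i<m. reflect m u Q (i, k) * reflect m u Q (i, l)) =
        (\<Sum>i<m. Q (i, k) * Q (i, l) - c * w l * (u i * Q (i, k)) - c * w k * (u i * Q (i, l))
            + c * c * w k * w l * (u i)\<^sup>2)"
      using that by (intro sum.cong refl)
        (simp add: h power2_eq_square algebra_simps)
    also have "\<dots> = of_bool (k = l) - c * w l * w k - c * w k * w l
         + c * (c * (\<Sum>i<m. (u i)\<^sup>2)) * (w k * w l)"
      using Q that by (simp add: sum.distrib sum_subtractf sum_distrib_left[symmetric] orth_funs_def w_def)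
    also have "\<dots> = of_bool (k = l)" unfolding c by (simp add: algebra_simps)
    finally show ?thesis .
  qed
  then show ?thesis by (auto simp: orth_funs_def reflect_def)
qed

text \<open>Take \<open>Q\<close> maximizing \<open>tr (Q B\<^sup>T)\<close> over the compact set of orthogonal matrices, and put
  \<open>H = Q B\<^sup>T\<close>. Replacing \<open>Q\<close> by \<open>R Q\<close> with \<open>R\<close> orthogonal changes the trace to \<open>tr (R H)\<close>, which cannot
  exceed \<open>tr H\<close>. For a single reflection \<open>R\<close> this says that the quadratic form of \<open>H\<close> is nonnegative;
  for the product of two reflections, a plane rotation, it says that \<open>H\<close> is symmetric.\<close>

lemma polar_decomposition:
  fixes B :: "nat \<Rightarrow> nat \<Rightarrow> real"
  obtains Q where "Q \<in> orth_funs m"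
    "\<And>i j. i < m \<Longrightarrow> j < m \<Longrightarrow> (\<Sum>k<m. Q (i, k) * B j k) = (\<Sum>k<m. Q (j, k) * B i k)"
    "\<And>x. (\<Sum>i<m. \<Sum>j<m. x i * (\<Sum>k<m. Q (i, k) * B j k) * x j) \<ge> 0"
proof -
  define F where "F Q = (\<Sum>i<m. \<Sum>k<m. Q (i, k) * B i k)" for Q :: "nat \<times> nat \<Rightarrow> real"
  define H where "H Q i j = (\<Sum>k<m. Q (i, k) * B j k)" for Q :: "nat \<times> nat \<Rightarrow> real" and i j
  define N where "N u = (\<Sum>i<m. (u i)\<^sup>2)" for u :: "nat \<Rightarrow> real"
  define D where "D Q u = (\<Sum>i<m. \<Sum>j<m. u i * H Q i j * u j)" for Q u
  have "continuous_on (orth_funs m) F"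
    unfolding F_def
    by (intro continuous_intros continuous_on_subset[OF continuous_on_product_coordinates subset_UNIV])
  then obtain Q where Q: "Q \<in> orth_funs m" and max: "\<And>R. R \<in> orth_funs m \<Longrightarrow> F R \<le> F Q"
    using continuous_attains_sup[OF compact_orth_funs, of m F] id_in_orth_funs by blast
  have HH: "H (reflect m u R) i j = H R i j - 2 / N u * u i * (\<Sum>l<m. u l * H R l j)"
    if "i < m" for u R i j
  proof -
    have "H (reflect m u R) i j =
        (\<Sum>k<m. R (i, k) * B j k - 2 / N u * u i * (\<Sum>l<m. u l * (R (l, k) * B j k)))"
      unfolding H_def reflect_def N_def using that
      by (intro sum.cong refl) (simp add: algebra_simps sum_distrib_left sum_distrib_right)
    also have "\<dots> = H R i j - 2 / N u * u i * (\<Sum>k<m. \<Sum>l<m. u l * (R (l, k) * B j k))"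
      by (simp add: sum_subtractf sum_distrib_left H_def)
    also have "(\<Sum>k<m. \<Sum>l<m. u l * (R (l, k) * B j k)) = (\<Sum>l<m. u l * H R l j)"
      by (subst sum.swap) (simp add: H_def sum_distrib_left)
    finally show ?thesis .
  qed
  have FH: "F R = (\<Sum>i<m. H R i i)" for R by (simp add: F_def H_def)
  have FF: "F (reflect m u R) = F R - 2 / N u * D R u" for u R
  proof -
    have "F (reflect m u R) = F R - (\<Sum>i<m. 2 / N u * u i * (\<Sum>l<m. u l * H R l i))"
      by (simp add: FH HH sum_subtractf)
    also have "(\<Sum>i<m. 2 / N u * u i * (\<Sum>l<m. u l * H R l i)) = 2 / N u * D R u"
    proof -
      have "D R u = (\<Sum>j<m. \<Sum>i<m. u i * H R i j * u j)"
        unfolding D_def by (rule sum.swap)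
      then show ?thesis by (simp add: sum_distrib_left algebra_simps)
    qed
    finally show ?thesis .
  qed
  have psd: "D Q x \<ge> 0" for x
  proof (cases "N x = 0")
    case True
    then have "\<And>i. i < m \<Longrightarrow> x i = 0"
      unfolding N_def by (subst (asm) sum_nonneg_eq_0_iff) auto
    then show ?thesis by (simp add: D_def)
  next
    case False
    then have "N x > 0" by (simp add: N_def order_less_le sum_nonneg)
    moreover have "F Q - 2 / N x * D Q x \<le> F Q"
      using max[OF reflect_orth_funs[OF Q, of x]] FF by simp
    ultimately show ?thesis by (simp add: zero_le_divide_iff)
  qed
  have sym: "H Q p q = H Q q p" if pq: "p < m" "q < m" for p q
  proof (cases "p = q")
    case False
    define d where "d = H Q q p - H Q p q"
    define a where "a = H Q p p + H Q q q"
    have quad: "t\<^sup>2 * a + t * d \<ge> 0" for t :: real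
    proof -
      \<comment> \<open>Reflecting first in \<open>e\<^sub>p\<close> and then in \<open>e\<^sub>p + t e\<^sub>q\<close> is a small rotation in the plane of
          the two coordinates; the linear term in \<open>t\<close> of the change of the trace is the antisymmetric
          part of \<open>H\<close> and has to vanish.\<close>
      define u :: "nat \<Rightarrow> real" where "u i = of_bool (i = p)" for i
      define v :: "nat \<Rightarrow> real" where "v i = of_bool (i = p) + t * of_bool (i = q)" for i
      define R where "R = reflect m u Q"
      have u: "(\<Sum>i<m. u i * f i) = f p" "(\<Sum>i<m. f i * u i) = f p" for f :: "nat \<Rightarrow> real"
      proof -
        have "(\<Sum>i<m. u i * f i) = (\<Sum>i<m. if i = p then f i else 0)"
          by (intro sum.cong refl) (simp add: u_def)
        then show "(\<Sum>i<m. u i * f i) = f p" using pq by simp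
        then show "(\<Sum>i<m. f i * u i) = f p" by (simp only: mult.commute)
      qed
      have v: "(\<Sum>i<m. v i * f i) = f p + t * f q" "(\<Sum>i<m. f i * v i) = f p + t * f q"
        for f :: "nat \<Rightarrow> real"
      proof -
        have "(\<Sum>i<m. v i * f i) = (\<Sum>i<m. (if i = p then f i else 0) + (if i = q then t * f i else 0))"
          by (intro sum.cong refl) (simp add: v_def algebra_simps)
        then show "(\<Sum>i<m. v i * f i) = f p + t * f q" using pq by (simp add: sum.distrib)
        then show "(\<Sum>i<m. f i * v i) = f p + t * f q" by (simp only: mult.commute)
      qed
      have Nu: "N u = 1" unfolding N_def power2_eq_square u by (simp add: u_def)
      have Nv: "N v = 1 + t\<^sup>2" unfolding N_def power2_eq_square v using False by (simp add: v_def)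
      have Du: "D Q u = H Q p p"
        unfolding D_def mult.assoc sum_distrib_left[symmetric] u ..
      have Dv: "D R v = H R p p + t * H R p q + t * (H R q p + t * H R q q)" 
        unfolding D_def mult.assoc sum_distrib_left[symmetric] v by (simp add: algebra_simps)
      have HR: "H R i j = H Q i j - 2 * u i * H Q p j" if "i < m" for i j
        unfolding R_def HH[OF that] Nu u by simp
      have "F (reflect m v R) \<le> F Q"
        unfolding R_def by (intro max reflect_orth_funs Q)
      then have "2 * H Q p p + 2 / (1 + t\<^sup>2) * D R v \<ge> 0"
        unfolding FF Nv by (simp add: R_def FF Nu Du)
      then have "0 \<le> (1 + t\<^sup>2) * (2 * H Q p p + 2 / (1 + t\<^sup>2) * D R v)" by simp
      also have "\<dots> = 2 * ((1 + t\<^sup>2) * H Q p p + D R v)"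
        using sum_power2_eq_zero_iff[of 1 t] by (simp add: field_simps)
      finally have "0 \<le> (1 + t\<^sup>2) * H Q p p + D R v" by simp
      then show ?thesis
        unfolding Dv HR[OF pq(1)] HR[OF pq(2)] using False
        by (simp add: u_def a_def d_def algebra_simps power2_eq_square)
    qed
    have a: "a \<ge> 0" using quad[of 1] quad[of "-1"] by simp
    define t where "t = d / (a + 1)"
    have d: "d = t * (a + 1)" using a by (simp add: t_def)
    have "t\<^sup>2 * a - t * d = - t\<^sup>2" by (simp add: d power2_eq_square algebra_simps)
    with quad[of "- t"] have "t\<^sup>2 \<le> 0" by simp
    then have "d = 0" by (simp add: d)
    then show ?thesis by (simp add: d_def)
  qed simp
  show thesis
    using that[OF Q] sym psd unfolding H_def D_def by blast
qed

text \<open>The best choice of \<open>Q\<close> makes \<open>tr (Q B\<^sup>T)\<close> the sum of the singular values of \<open>B\<close>. Each singular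
  value satisfies \<open>s \<ge> 3 s\<^sup>2 / (2 c) - s\<^sup>4 / (2 c\<^sup>3)\<close>, since \<open>s (s - c)\<^sup>2 (s + 2 c) \<ge> 0\<close>. The right-hand side sums
  to a polynomial in the entries of \<open>B\<close>, so its expectation for random \<open>B\<close> is accessible. The
  inequality between matrices is obtained from the polar decomposition of \<open>B\<close>, without passing to
  singular values.\<close>

lemma frame_lower_bound:
  fixes B :: "nat \<Rightarrow> nat \<Rightarrow> real"
  assumes "r \<le> m" and c: "c > 0"
  obtains Q :: "nat \<Rightarrow> nat \<Rightarrow> real"
  where "\<And>i j. i < r \<Longrightarrow> j < r \<Longrightarrow> (\<Sum>k<m. Q i k * Q j k) = of_bool (i = j)"
    and "(\<Sum>j<r. 3 / (2 * c) * (\<Sum>k<m. (B j k)\<^sup>2)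
            - 1 / (2 * c ^ 3) * (\<Sum>i<r. (\<Sum>k<m. B i k * B j k)\<^sup>2))
         \<le> (\<Sum>i<r. \<Sum>k<m. Q i k * B i k)"
proof -
  \<comment> \<open>Padding by zero rows makes the matrix square, without changing the traces involved.\<close>
  define B' where "B' i k = (if i < r then B i k else 0)" for i k
  obtain Q where Q: "Q \<in> orth_funs m"
    and symm: "\<And>i j. i < m \<Longrightarrow> j < m \<Longrightarrow> (\<Sum>k<m. Q (i, k) * B' j k) = (\<Sum>k<m. Q (j, k) * B' i k)"
    and psd: "\<And>x. (\<Sum>i<m. \<Sum>j<m. x i * (\<Sum>k<m. Q (i, k) * B' j k) * x j) \<ge> 0"
    using polar_decomposition[of m B'] by blast
  define H where "H i j = (\<Sum>k<m. Q (i, k) * B' j k)" for i j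
  have H_sym: "H i j = H j i" if "i < m" "j < m" for i j
    using symm[OF that] by (simp add: H_def)
  have H_sq: "(\<Sum>i<m. H i j * H i l) = (\<Sum>k<m. B' j k * B' l k)" for j l
  proof -
    have "(\<Sum>i<m. H i j * H i l) = (\<Sum>i<m. \<Sum>k<m. \<Sum>k'<m. B' j k * B' l k' * (Q (i, k) * Q (i, k')))"
      by (simp add: H_def sum_product algebra_simps)
    also have "\<dots> = (\<Sum>k<m. \<Sum>i<m. \<Sum>k'<m. B' j k * B' l k' * (Q (i, k) * Q (i, k')))"
      by (rule sum.swap)
    also have "\<dots> = (\<Sum>k<m. \<Sum>k'<m. \<Sum>i<m. B' j k * B' l k' * (Q (i, k) * Q (i, k')))"
      by (intro sum.cong refl sum.swap)
    also have "\<dots> = (\<Sum>k<m. \<Sum>k'<m. B' j k * B' l k' * (\<Sum>i<m. Q (i, k) * Q (i, k')))"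
      by (simp add: sum_distrib_left)
    also have "\<dots> = (\<Sum>k<m. \<Sum>k'<m. B' j k * B' l k' * of_bool (k = k'))"
      using Q by (intro sum.cong refl) (auto simp: orth_funs_def)
    also have "\<dots> = (\<Sum>k<m. B' j k * B' l k)"
      by (intro sum.cong refl) (simp add: of_bool_def if_distrib sum.delta cong: if_cong)
    finally show ?thesis .
  qed
  have diag: "3 / (2 * c) * (\<Sum>k<m. (B' j k)\<^sup>2)
            - 1 / (2 * c ^ 3) * (\<Sum>i<m. (\<Sum>k<m. B' i k * B' j k)\<^sup>2) \<le> H j j" if j: "j < m" for j
  proof -
    \<comment> \<open>With \<open>h = H e\<^sub>j\<close> and \<open>g = H\<^sup>2 e\<^sub>j\<close>, the two nonnegative quantities below are
        \<open>e\<^sub>j \<bullet> (H - c) H (H - c) e\<^sub>j\<close> and \<open>|H (H - c) e\<^sub>j|\<^sup>2\<close>. Adding \<open>2 c\<close> times the first to the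
        second gives \<open>e\<^sub>j \<bullet> H (H - c)\<^sup>2 (H + 2 c) e\<^sub>j \<ge> 0\<close>.\<close>
    define h where "h i = H i j" for i
    define g where "g i = (\<Sum>l<m. H i l * h l)" for i
    define e where "e i = (of_bool (i = j) :: real)" for i
    have e: "(\<Sum>i<m. e i * f i) = f j" "(\<Sum>i<m. f i * e i) = f j" for f :: "nat \<Rightarrow> real"
      using j by (simp_all add: e_def of_bool_def if_distrib if_distribR sum.delta cong: if_cong)
    have g_eq: "g i = (\<Sum>k<m. B' i k * B' j k)" if "i < m" for i
      unfolding H_sq[symmetric] g_def h_def using that H_sym by (intro sum.cong refl) auto
    have gj: "g j = (\<Sum>i<m. h i * h i)"
      unfolding g_def h_def using j H_sym by (intro sum.cong refl) auto
    have Hx: "(\<Sum>l<m. H i l * (h l - c * e l)) = g i - c * h i" for i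
    proof -
      have "(\<Sum>l<m. H i l * (h l - c * e l)) = (\<Sum>l<m. H i l * h l - c * (H i l * e l))"
        by (intro sum.cong refl) (simp add: algebra_simps)
      also have "\<dots> = g i - c * h i"
        by (simp add: sum_subtractf sum_distrib_left[symmetric] e) (simp add: g_def h_def)
      finally show ?thesis .
    qed
    have "0 \<le> (\<Sum>i<m. \<Sum>l<m. (h i - c * e i) * H i l * (h l - c * e l))"
      using psd[of "\<lambda>i. h i - c * e i"] by (simp add: H_def)
    also have "\<dots> = (\<Sum>i<m. (h i - c * e i) * (g i - c * h i))"
      by (simp add: mult.assoc sum_distrib_left[symmetric] Hx)
    also have "\<dots> = (\<Sum>i<m. h i * g i - c * (h i * h i) - c * (e i * g i) + c * c * (e i * h i))"
      by (intro sum.cong refl) (simp add: algebra_simps)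
    also have "\<dots> = (\<Sum>i<m. h i * g i) - 2 * c * (\<Sum>i<m. h i * h i) + c * c * h j"
      by (simp add: sum.distrib sum_subtractf sum_distrib_left[symmetric] e gj)
    finally have 1: "0 \<le> (\<Sum>i<m. h i * g i) - 2 * c * (\<Sum>i<m. h i * h i) + c * c * h j" .
    have "0 \<le> (\<Sum>i<m. (g i - c * h i)\<^sup>2)" by (intro sum_nonneg) auto
    also have "\<dots> = (\<Sum>i<m. (g i)\<^sup>2 - 2 * c * (h i * g i) + c * c * (h i * h i))"
      by (intro sum.cong refl) (simp add: power2_eq_square algebra_simps)
    also have "\<dots> = (\<Sum>i<m. (g i)\<^sup>2) - 2 * c * (\<Sum>i<m. h i * g i) + c * c * (\<Sum>i<m. h i * h i)"
      by (simp add: sum.distrib sum_subtractf sum_distrib_left[symmetric])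
    finally have 2: "0 \<le> (\<Sum>i<m. (g i)\<^sup>2) - 2 * c * (\<Sum>i<m. h i * g i) + c * c * (\<Sum>i<m. h i * h i)" .
    from 1 c have "0 \<le> 2 * c * ((\<Sum>i<m. h i * g i) - 2 * c * (\<Sum>i<m. h i * h i) + c * c * h j)"
      by simp
    with 2 have "3 * c\<^sup>2 * (\<Sum>i<m. h i * h i) - (\<Sum>i<m. (g i)\<^sup>2) \<le> 2 * c ^ 3 * h j"
      by (simp add: power2_eq_square power3_eq_cube algebra_simps)
    then have "(3 * c\<^sup>2 * (\<Sum>i<m. h i * h i) - (\<Sum>i<m. (g i)\<^sup>2)) / (2 * c ^ 3) \<le> h j"
      using c by (simp add: pos_divide_le_eq mult.commute)
    moreover have "(3 * c\<^sup>2 * (\<Sum>i<m. h i * h i) - (\<Sum>i<m. (g i)\<^sup>2)) / (2 * c ^ 3)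
        = 3 / (2 * c) * (\<Sum>i<m. h i * h i) - 1 / (2 * c ^ 3) * (\<Sum>i<m. (g i)\<^sup>2)"
      using c by (simp add: field_simps power2_eq_square power3_eq_cube)
    moreover have "(\<Sum>i<m. h i * h i) = (\<Sum>k<m. (B' j k)\<^sup>2)"
      unfolding h_def H_sq by (simp add: power2_eq_square)
    ultimately show ?thesis by (simp add: g_eq h_def)
  qed
  have "(\<Sum>j<r. 3 / (2 * c) * (\<Sum>k<m. (B j k)\<^sup>2)
            - 1 / (2 * c ^ 3) * (\<Sum>i<r. (\<Sum>k<m. B i k * B j k)\<^sup>2)) \<le> (\<Sum>j<r. H j j)"
  proof (rule sum_mono)
    fix j assume "j \<in> {..<r}"
    then have j: "j < r" "j < m" using \<open>r \<le> m\<close> by auto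
    have "(\<Sum>i<r. (\<Sum>k<m. B i k * B j k)\<^sup>2) = (\<Sum>i<m. (\<Sum>k<m. B' i k * B' j k)\<^sup>2)"
      using j \<open>r \<le> m\<close> by (intro sum.mono_neutral_cong_left) (auto simp: B'_def)
    with diag[OF j(2)] j show "3 / (2 * c) * (\<Sum>k<m. (B j k)\<^sup>2)
            - 1 / (2 * c ^ 3) * (\<Sum>i<r. (\<Sum>k<m. B i k * B j k)\<^sup>2) \<le> H j j"
      by (simp add: B'_def)
  qed
  also have "(\<Sum>j<r. H j j) = (\<Sum>i<r. \<Sum>k<m. Q (i, k) * B i k)"
    by (simp add: H_def B'_def)
  finally have bound: "(\<Sum>j<r. 3 / (2 * c) * (\<Sum>k<m. (B j k)\<^sup>2)
            - 1 / (2 * c ^ 3) * (\<Sum>i<r. (\<Sum>k<m. B i k * B j k)\<^sup>2))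
            \<le> (\<Sum>i<r. \<Sum>k<m. Q (i, k) * B i k)" .
  \<comment> \<open>Orthonormality is known for the columns of \<open>Q\<close>; a one-sided inverse of a square matrix is
      two-sided, so it holds for the rows as well.\<close>
  define A where "A = mat m m Q"
  have A: "A \<in> carrier_mat m m" "A\<^sup>T \<in> carrier_mat m m" by (auto simp: A_def)
  have "A\<^sup>T * A = 1\<^sub>m m"
    using Q by (intro eq_matI) (auto simp: A_def scalar_prod_def orth_funs_def atLeast0LessThan)
  then have AA: "A * A\<^sup>T = 1\<^sub>m m"
    using mat_mult_left_right_inverse[OF A(2,1)] by simp
  have rows: "(\<Sum>k<m. Q (i, k) * Q (j, k)) = of_bool (i = j)" if "i < r" "j < r" for i j
  proof -
    have "(\<Sum>k<m. Q (i, k) * Q (j, k)) = (A * A\<^sup>T) $$ (i, j)"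
      using that \<open>r \<le> m\<close> by (simp add: A_def scalar_prod_def atLeast0LessThan)
    then show ?thesis using that \<open>r \<le> m\<close> by (simp add: AA)
  qed
  show thesis
    using that[of "\<lambda>i k. Q (i, k)"] rows bound by blast
qed

section \<open>The maximal energy of a projected matrix\<close>

text \<open>The projections of rank \<open>r\<close>, as elements of a space with a topology; the values outside the
  index range are fixed for the sake of compactness.\<close>

definition projs :: "nat \<Rightarrow> nat \<Rightarrow> (nat \<times> nat \<Rightarrow> real) set" where
  "projs M r = {p. (\<forall>i<M. \<forall>j<M. p (i, j) = p (j, i)) \<and>
                   (\<forall>i<M. \<forall>j<M. (\<Sum>k<M. p (i, k) * p (k, j)) = p (i, j)) \<and>
                   (\<Sum>i<M. p (i, i)) = real r \<and>
                   (\<forall>ij. ij \<notin> {..<M} \<times> {..<M} \<longrightarrow> p ij = 0)}"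

lemma projsD:
  assumes "p \<in> projs M r"
  shows projs_sym: "i < M \<Longrightarrow> j < M \<Longrightarrow> p (i, j) = p (j, i)"
    and projs_idem: "i < M \<Longrightarrow> j < M \<Longrightarrow> (\<Sum>k<M. p (i, k) * p (k, j)) = p (i, j)"
    and projs_trace: "(\<Sum>i<M. p (i, i)) = real r"
    and projs_outside: "ij \<notin> {..<M} \<times> {..<M} \<Longrightarrow> p ij = 0"
  using assms unfolding projs_def by blast+

lemma orth_projs_eq: "orth_projs M r = mat M M ` projs M r"
proof (intro equalityI subsetI)
  fix A assume "A \<in> orth_projs M r"
  then have A: "A \<in> carrier_mat M M" "A\<^sup>T = A" "A * A = A" "(\<Sum>i<M. A $$ (i, i)) = real r"
    by (auto simp: orth_projs_iff)
  define p where "p = (\<lambda>ij. if ij \<in> {..<M} \<times> {..<M} then A $$ ij else 0)"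
  have "A = mat M M p" using A(1) by (intro eq_matI) (auto simp: p_def)
  moreover have "p \<in> projs M r"
    unfolding projs_def
  proof (intro CollectI conjI allI impI)
    fix i j assume ij: "i < M" "j < M"
    have "A $$ (i, j) = A\<^sup>T $$ (i, j)" using A(2) by simp
    then show "p (i, j) = p (j, i)" using ij A(1) by (simp add: p_def)
    have "(\<Sum>k<M. A $$ (i, k) * A $$ (k, j)) = (A * A) $$ (i, j)"
      using ij A(1) by (simp add: scalar_prod_def atLeast0LessThan)
    then show "(\<Sum>k<M. p (i, k) * p (k, j)) = p (i, j)"
      using ij A(3) by (simp add: p_def)
  qed (use A(4) in \<open>auto simp: p_def\<close>)
  ultimately show "A \<in> mat M M ` projs M r" by blast
next
  fix A assume "A \<in> mat M M ` projs M r"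
  then obtain p where p: "A = mat M M p" "p \<in> projs M r" by blast
  have "(mat M M p)\<^sup>T = mat M M p"
    using projs_sym[OF p(2)] by (intro eq_matI) simp_all
  moreover have "mat M M p * mat M M p = mat M M p"
    using projs_idem[OF p(2)] by (intro eq_matI) (simp_all add: scalar_prod_def atLeast0LessThan)
  ultimately show "A \<in> orth_projs M r"
    using projs_trace[OF p(2)] by (simp add: orth_projs_iff p(1))
qed

lemma projs_sum_squares:
  assumes p: "p \<in> projs M r"
  shows "(\<Sum>i<M. \<Sum>k<M. (p (i, k))\<^sup>2) = real r"
proof -
  have "(\<Sum>k<M. (p (i, k))\<^sup>2) = p (i, i)" if "i < M" for i
  proof -
    have "(\<Sum>k<M. (p (i, k))\<^sup>2) = (\<Sum>k<M. p (i, k) * p (k, i))"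
      using projs_sym[OF p that] by (intro sum.cong refl) (simp add: power2_eq_square)
    then show ?thesis using projs_idem[OF p that that] by simp
  qed
  then show ?thesis using projs_trace[OF p] by simp
qed

lemma compact_projs: "compact (projs M r)"
proof (rule compact_pointwise_bounded[where b = "real r + 1"])
  show "closed (projs M r)"
    unfolding projs_def Collect_conj_eq imp_conv_disj
    by (intro closed_Int closed_Collect_all closed_Collect_disj closed_Collect_eq closed_Collect_const
          continuous_intros continuous_on_product_coordinates)
  fix p and ij :: "nat \<times> nat" assume p: "p \<in> projs M r"
  obtain i j where ij: "ij = (i, j)" by fastforce
  show "\<bar>p ij\<bar> \<le> real r + 1"
  proof (cases "i < M \<and> j < M")
    case True
    have "(p (i, j))\<^sup>2 \<le> (\<Sum>k<M. (p (i, k))\<^sup>2)"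
      using True by (intro member_le_sum) auto
    also have "\<dots> \<le> (\<Sum>i<M. \<Sum>k<M. (p (i, k))\<^sup>2)"
      using True by (intro member_le_sum[where f = "\<lambda>i. \<Sum>k<M. (p (i, k))\<^sup>2"]) (auto intro: sum_nonneg)
    also have "\<dots> = real r" by (rule projs_sum_squares[OF p])
    also have "\<dots> \<le> (real r + 1)\<^sup>2" by (simp add: power2_eq_square algebra_simps)
    finally show ?thesis using ij abs_le_square_iff[of "p ij" "real r + 1"] by simp
  qed (use projs_outside[OF p] ij in auto)
qed

lemma projs_nonempty:
  assumes "r \<le> M"
  shows "projs M r \<noteq> {}"
proof -
  define p :: "nat \<times> nat \<Rightarrow> real" where "p = (\<lambda>(i, j). if i = j \<and> i < r then 1 else 0)"
  have "p \<in> projs M r"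
    unfolding projs_def
  proof (intro CollectI conjI allI impI)
    fix i j assume "i < M" "j < M"
    show "p (i, j) = p (j, i)" by (auto simp: p_def)
    have "(\<Sum>k<M. p (i, k) * p (k, j)) = (\<Sum>k<M. if k = i then p (i, j) else 0)"
      by (intro sum.cong refl) (simp add: p_def)
    also have "\<dots> = p (i, j)" using \<open>i < M\<close> by simp
    finally show "(\<Sum>k<M. p (i, k) * p (k, j)) = p (i, j)" .
  next
    have "(\<Sum>i<M. p (i, i)) = (\<Sum>i<r. 1)"
      using assms by (intro sum.mono_neutral_cong_right) (auto simp: p_def)
    then show "(\<Sum>i<M. p (i, i)) = real r" by simp
  next
    fix ij assume "ij \<notin> {..<M} \<times> {..<M}"
    then show "p ij = 0" using assms by (cases ij) (auto simp: p_def)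
  qed
  then show ?thesis by blast
qed

text \<open>The squared Hilbert-Schmidt norm of the matrix product \<open>p x\<close>.\<close>

definition energy :: "nat \<Rightarrow> (nat \<times> nat \<Rightarrow> real) \<Rightarrow> (nat \<times> nat \<Rightarrow> real) \<Rightarrow> real" where
  "energy M p x = (\<Sum>i<M. \<Sum>j<M. (\<Sum>k<M. p (i, k) * x (k, j))\<^sup>2)"

lemma hs_norm_mult_mat: "(hs_norm (mat M M p * mat M M x))\<^sup>2 = energy M p x"
proof -
  have "(\<Sum>i<dim_row (mat M M p * mat M M x). \<Sum>j<dim_col (mat M M p * mat M M x).
      ((mat M M p * mat M M x) $$ (i, j))\<^sup>2) = energy M p x"
    by (simp add: energy_def scalar_prod_def atLeast0LessThan)
  moreover have "0 \<le> energy M p x" unfolding energy_def by (intro sum_nonneg) auto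
  ultimately show ?thesis unfolding hs_norm_def by simp
qed

lemma energy_uminus: "energy M p (\<lambda>ij. - x ij) = energy M p x"
  by (simp add: energy_def sum_negf)

text \<open>The trace of the matrix product \<open>p x\<close>.\<close>

definition overlap :: "nat \<Rightarrow> (nat \<times> nat \<Rightarrow> real) \<Rightarrow> (nat \<times> nat \<Rightarrow> real) \<Rightarrow> real" where
  "overlap M p x = (\<Sum>i<M. \<Sum>k<M. p (i, k) * x (k, i))"

lemma overlap_uminus: "overlap M p (\<lambda>ij. - x ij) = - overlap M p x"
  by (simp add: overlap_def sum_negf)

definition scalar_fun :: "real \<Rightarrow> nat \<times> nat \<Rightarrow> real" where
  "scalar_fun a = (\<lambda>(i, j). a * of_bool (i = j))"

text \<open>Expand the square: the constant term is \<open>|p|\<^sup>2 = tr p = r\<close>, and the cross term is the trace of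
  \<open>p\<^sup>T p x = p x\<close>. The dependence on \<open>p\<close> of the terms linear and quadratic in \<open>x\<close> is what the two parts of
  the theorem exploit.\<close>

lemma energy_shift:
  assumes p: "p \<in> projs M r"
  shows "energy M p (\<lambda>ij. scalar_fun a ij + x ij)
    = a\<^sup>2 * real r + 2 * a * overlap M p x + energy M p x"
proof -
  define y where "y i j = (\<Sum>k<M. p (i, k) * x (k, j))" for i j
  have s: "(\<Sum>k<M. p (i, k) * (scalar_fun a (k, j) + x (k, j))) = a * p (i, j) + y i j" if "j < M" for i j
  proof -
    have "(\<Sum>k<M. p (i, k) * (scalar_fun a (k, j) + x (k, j)))
        = (\<Sum>k<M. if k = j then a * p (i, j) else 0) + y i j"
      unfolding y_def sum.distrib[symmetric]
      by (intro sum.cong refl) (simp add: scalar_fun_def algebra_simps)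
    then show ?thesis using that by simp
  qed
  have "(\<Sum>i<M. \<Sum>j<M. p (i, j) * y i j) = (\<Sum>i<M. \<Sum>j<M. \<Sum>k<M. p (i, j) * p (i, k) * x (k, j))"
    by (simp add: y_def sum_distrib_left mult.assoc)
  also have "\<dots> = (\<Sum>j<M. \<Sum>i<M. \<Sum>k<M. p (i, j) * p (i, k) * x (k, j))"
    by (rule sum.swap)
  also have "\<dots> = (\<Sum>j<M. \<Sum>k<M. \<Sum>i<M. p (i, j) * p (i, k) * x (k, j))"
    by (intro sum.cong refl sum.swap)
  also have "\<dots> = (\<Sum>j<M. \<Sum>k<M. (\<Sum>i<M. p (j, i) * p (i, k)) * x (k, j))"
    unfolding sum_distrib_right using projs_sym[OF p] by (intro sum.cong refl) simp
  also have "\<dots> = overlap M p x"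
    using projs_idem[OF p] by (simp add: overlap_def)
  finally have cross: "(\<Sum>i<M. \<Sum>j<M. p (i, j) * y i j) = overlap M p x" .
  have "energy M p (\<lambda>ij. scalar_fun a ij + x ij) = (\<Sum>i<M. \<Sum>j<M. (a * p (i, j) + y i j)\<^sup>2)"
    by (simp add: energy_def s)
  also have "\<dots> = (\<Sum>i<M. \<Sum>j<M. a\<^sup>2 * (p (i, j))\<^sup>2 + 2 * a * (p (i, j) * y i j) + (y i j)\<^sup>2)"
    by (intro sum.cong refl) (simp add: power2_eq_square algebra_simps)
  also have "\<dots> = a\<^sup>2 * real r + 2 * a * overlap M p x + energy M p x"
    by (simp add: sum.distrib sum_distrib_left[symmetric] cross projs_sum_squares[OF p])
      (simp add: energy_def y_def)
  finally show ?thesis .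
qed

lemma energy_nonneg: "0 \<le> energy M p x"
  by (auto simp: energy_def intro!: sum_nonneg)

lemma energy_le:
  assumes p: "p \<in> projs M r"
  shows "energy M p x \<le> real r * (\<Sum>i<M. \<Sum>j<M. (x (i, j))\<^sup>2)"
proof -
  have "energy M p x \<le> (\<Sum>i<M. \<Sum>j<M. (\<Sum>k<M. (p (i, k))\<^sup>2) * (\<Sum>k<M. (x (k, j))\<^sup>2))"
    unfolding energy_def by (intro sum_mono Cauchy_Schwarz_ineq_sum)
  also have "\<dots> = (\<Sum>i<M. \<Sum>k<M. (p (i, k))\<^sup>2) * (\<Sum>j<M. \<Sum>k<M. (x (k, j))\<^sup>2)"
    by (rule sum_product[symmetric])
  also have "(\<Sum>j<M. \<Sum>k<M. (x (k, j))\<^sup>2) = (\<Sum>i<M. \<Sum>j<M. (x (i, j))\<^sup>2)"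
    by (rule sum.swap)
  finally show ?thesis by (simp add: projs_sum_squares[OF p])
qed

definition max_energy :: "nat \<Rightarrow> nat \<Rightarrow> (nat \<times> nat \<Rightarrow> real) \<Rightarrow> real" where
  "max_energy M r x = (hs_norm (pi_hat M r (mat M M x) * mat M M x))\<^sup>2"

lemma arg_max_on_attained:
  fixes f :: "'b \<Rightarrow> 'c::linorder"
  assumes "q \<in> S" "\<And>p. p \<in> S \<Longrightarrow> f p \<le> f q"
  shows "arg_max_on f S \<in> S" "\<And>p. p \<in> S \<Longrightarrow> f p \<le> f (arg_max_on f S)"
proof -
  have "is_arg_max f (\<lambda>p. p \<in> S) q" using assms by (auto simp: is_arg_max_linorder)
  then have "is_arg_max f (\<lambda>p. p \<in> S) (arg_max_on f S)"
    unfolding arg_max_on_def arg_max_def by (rule someI)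
  then show "arg_max_on f S \<in> S" "\<And>p. p \<in> S \<Longrightarrow> f p \<le> f (arg_max_on f S)"
    by (auto simp: is_arg_max_linorder)
qed

lemma max_energy:
  assumes "r \<le> M"
  shows max_energy_attained: "\<exists>p\<in>projs M r. max_energy M r x = energy M p x"
    and max_energy_ge: "p \<in> projs M r \<Longrightarrow> energy M p x \<le> max_energy M r x"
proof -
  have "continuous_on (projs M r) (\<lambda>p. energy M p x)"
    unfolding energy_def
    by (intro continuous_intros continuous_on_subset[OF continuous_on_product_coordinates subset_UNIV])
  then obtain q where q: "q \<in> projs M r" "\<And>p. p \<in> projs M r \<Longrightarrow> energy M p x \<le> energy M q x"
    using continuous_attains_sup[OF compact_projs projs_nonempty[OF assms]] by blast
  let ?f = "\<lambda>A. (hs_norm (A * mat M M x))\<^sup>2"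
  have 1: "mat M M q \<in> orth_projs M r"
    unfolding orth_projs_eq using q(1) by (rule imageI)
  have 2: "?f A \<le> ?f (mat M M q)" if A: "A \<in> orth_projs M r" for A
  proof -
    obtain p where p: "p \<in> projs M r" "A = mat M M p"
      using A unfolding orth_projs_eq by (rule imageE)
    show ?thesis
      unfolding p(2) hs_norm_mult_mat by (rule q(2)[OF p(1)])
  qed
  have max: "arg_max_on ?f (orth_projs M r) \<in> orth_projs M r"
    "\<And>A. A \<in> orth_projs M r \<Longrightarrow> ?f A \<le> ?f (arg_max_on ?f (orth_projs M r))"
    using arg_max_on_attained[where f = ?f, OF 1] 2 by blast+
  have pi: "arg_max_on ?f (orth_projs M r) = pi_hat M r (mat M M x)"
    unfolding pi_hat_def ..
  obtain p' where p': "p' \<in> projs M r" "pi_hat M r (mat M M x) = mat M M p'"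
    using max(1) unfolding pi unfolding orth_projs_eq by (rule imageE)
  have val: "max_energy M r x = energy M p' x"
    unfolding max_energy_def p'(2) by (rule hs_norm_mult_mat)
  then show "\<exists>p\<in>projs M r. max_energy M r x = energy M p x" using p'(1) by blast
  show "energy M p x \<le> max_energy M r x" if "p \<in> projs M r"
  proof -
    have "mat M M p \<in> orth_projs M r" unfolding orth_projs_eq using that by (rule imageI)
    from max(2)[OF this] show ?thesis
      unfolding pi p'(2) hs_norm_mult_mat val .
  qed
qed

text \<open>A superlevel set of a pointwise supremum of continuous functions is a union of open sets.\<close>

lemma max_energy_measurable:
  assumes "r \<le> M"
  shows "max_energy M r \<in> borel_measurable borel"
  unfolding borel_measurable_iff_greater
proof
  fix a
  have "{x \<in> space borel. a < max_energy M r x} = (\<Union>p\<in>projs M r. {x. a < energy M p x})"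
  proof (intro equalityI subsetI)
    fix x assume "x \<in> {x \<in> space borel. a < max_energy M r x}"
    then show "x \<in> (\<Union>p\<in>projs M r. {x. a < energy M p x})"
      using max_energy_attained[OF assms, of x] by auto
  next
    fix x assume "x \<in> (\<Union>p\<in>projs M r. {x. a < energy M p x})"
    then obtain p where "p \<in> projs M r" "a < energy M p x" by blast
    then show "x \<in> {x \<in> space borel. a < max_energy M r x}"
      using max_energy_ge[OF assms, of p x] by simp
  qed
  also have "open \<dots>"
    unfolding energy_def
    by (intro open_UN ballI open_Collect_less continuous_intros continuous_on_product_coordinates)
  finally show "{x \<in> space borel. a < max_energy M r x} \<in> sets borel" by simp
qed

lemma max_energy_bounds:
  assumes "r \<le> M"
  shows "0 \<le> max_energy M r x" "max_energy M r x \<le> real r * (\<Sum>i<M. \<Sum>j<M. (x (i, j))\<^sup>2)"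
proof -
  obtain p where "p \<in> projs M r" "max_energy M r x = energy M p x"
    using max_energy_attained[OF assms] by blast
  then show "0 \<le> max_energy M r x" "max_energy M r x \<le> real r * (\<Sum>i<M. \<Sum>j<M. (x (i, j))\<^sup>2)"
    using energy_nonneg[of M p x] energy_le[of p M r x] by simp_all
qed

text \<open>The linear terms for \<open>x\<close> and \<open>- x\<close> cancel when a projection that is optimal for \<open>x\<close> without the
  scalar shift is used for both.\<close>

lemma max_energy_reflection:
  assumes "r \<le> M"
  shows "2 * a\<^sup>2 * real r + 2 * max_energy M r x
    \<le> max_energy M r (\<lambda>ij. scalar_fun a ij + x ij) + max_energy M r (\<lambda>ij. scalar_fun a ij + - x ij)"
proof -
  obtain p where p: "p \<in> projs M r" "max_energy M r x = energy M p x"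
    using max_energy_attained[OF assms] by blast
  show ?thesis
    using max_energy_ge[OF assms p(1), of "\<lambda>ij. scalar_fun a ij + x ij"]
      max_energy_ge[OF assms p(1), of "\<lambda>ij. scalar_fun a ij + - x ij"]
    unfolding energy_shift[OF p(1)] overlap_uminus energy_uminus p(2) by linarith
qed

text \<open>Signs that keep the upper right \<open>r \<times> m\<close> block of a matrix of size \<open>r + m\<close> and reverse all
  other entries.\<close>

definition flip_off_block :: "nat \<Rightarrow> nat \<times> nat \<Rightarrow> real" where
  "flip_off_block r = (\<lambda>(i, j). if i < r \<and> r \<le> j then 1 else -1)"

text \<open>The polynomial lower bound for the sum of the singular values of the upper right block.\<close>

definition block_gain :: "nat \<Rightarrow> nat \<Rightarrow> real \<Rightarrow> (nat \<times> nat \<Rightarrow> real) \<Rightarrow> real" where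
  "block_gain r m c x = (\<Sum>j<r. 3 / (2 * c) * (\<Sum>k<m. (x (j, r + k))\<^sup>2)
            - 1 / (2 * c ^ 3) * (\<Sum>i<r. (\<Sum>k<m. x (i, r + k) * x (j, r + k))\<^sup>2))"

lemma sum_lessThan_add:
  fixes f :: "nat \<Rightarrow> 'b::comm_monoid_add"
  shows "(\<Sum>k<r + m. f k) = (\<Sum>k<r. f k) + (\<Sum>k<m. f (r + k))"
  by (induction m) (simp_all add: add.assoc)

text \<open>Take \<open>p = W\<^sup>T W / 2\<close> with \<open>W = [1, Q]\<close>, where the rows of \<open>Q\<close> are orthonormal. As \<open>W W\<^sup>T = 2\<close>, this is
  a projection of rank \<open>r\<close>. In the sum over both signs only the upper right block \<open>B\<close> of \<open>x\<close> survives,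
  and it meets the block \<open>Q\<^sup>T / 2\<close> of \<open>p\<close>; the result is \<open>tr (Q B\<^sup>T)\<close>. The matrix \<open>Q\<close> may depend on \<open>B\<close> in
  any way, since only the bound by the explicit polynomial is retained.\<close>

lemma overlap_block_gain:
  assumes "r \<le> m" and c: "c > 0"
  obtains p where "p \<in> projs (r + m) r"
    "block_gain r m c x \<le> overlap (r + m) p x + overlap (r + m) p (\<lambda>ij. flip_off_block r ij * x ij)"
proof -
  define M where "M = r + m"
  obtain Q :: "nat \<Rightarrow> nat \<Rightarrow> real"
    where Q: "\<And>i j. i < r \<Longrightarrow> j < r \<Longrightarrow> (\<Sum>k<m. Q i k * Q j k) = of_bool (i = j)"
    and gain: "block_gain r m c x \<le> (\<Sum>i<r. \<Sum>k<m. Q i k * x (i, r + k))"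
    using frame_lower_bound[OF assms, where B = "\<lambda>i k. x (i, r + k)"]
    unfolding block_gain_def by blast
  define W where "W i k = (if k < r then of_bool (i = k) else Q i (k - r))" for i k
  have W: "(\<Sum>k<M. W i k * W j k) = 2 * of_bool (i = j)" if "i < r" "j < r" for i j
  proof -
    have "(\<Sum>k<r. W i k * W j k) = (\<Sum>k<r. if k = i then of_bool (i = j) else 0)"
      by (intro sum.cong refl) (auto simp: W_def)
    also have "\<dots> = of_bool (i = j)" using that by simp
    finally have 1: "(\<Sum>k<r. W i k * W j k) = of_bool (i = j)" .
    have "(\<Sum>k<m. W i (r + k) * W j (r + k)) = of_bool (i = j)"
      using Q[OF that] by (simp add: W_def)
    with 1 show ?thesis unfolding M_def sum_lessThan_add by simp
  qed
  define p where "p = (\<lambda>(k, l). if k < M \<and> l < M then 1/2 * (\<Sum>i<r. W i k * W i l) else 0)"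
  have p: "p \<in> projs M r"
    unfolding projs_def
  proof (intro CollectI conjI allI impI)
    fix k l assume "k < M" "l < M"
    then show "p (k, l) = p (l, k)" by (simp add: p_def mult.commute)
    have "(\<Sum>n<M. p (k, n) * p (n, l))
        = (\<Sum>n<M. \<Sum>i<r. \<Sum>j<r. 1/4 * (W i k * W j l) * (W i n * W j n))"
    proof (intro sum.cong refl)
      fix n assume "n \<in> {..<M}"
      then have "p (k, n) * p (n, l) = 1/4 * ((\<Sum>i<r. W i k * W i n) * (\<Sum>j<r. W j n * W j l))"
        using \<open>k < M\<close> \<open>l < M\<close> by (simp add: p_def)
      also have "\<dots> = (\<Sum>i<r. \<Sum>j<r. 1/4 * ((W i k * W i n) * (W j n * W j l)))"
        unfolding sum_product by (simp only: sum_distrib_left)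
      also have "\<dots> = (\<Sum>i<r. \<Sum>j<r. 1/4 * (W i k * W j l) * (W i n * W j n))"
        by (intro sum.cong refl) (simp only: mult_ac)
      finally show "p (k, n) * p (n, l) = \<dots>" .
    qed
    also have "\<dots> = (\<Sum>i<r. \<Sum>n<M. \<Sum>j<r. 1/4 * (W i k * W j l) * (W i n * W j n))"
      by (rule sum.swap)
    also have "\<dots> = (\<Sum>i<r. \<Sum>j<r. \<Sum>n<M. 1/4 * (W i k * W j l) * (W i n * W j n))"
      by (intro sum.cong refl sum.swap)
    also have "\<dots> = (\<Sum>i<r. \<Sum>j<r. 1/4 * (W i k * W j l) * (2 * of_bool (i = j)))"
      unfolding sum_distrib_left[symmetric] using W by (intro sum.cong refl) auto
    also have "\<dots> = (\<Sum>i<r. 1/2 * (W i k * W i l))"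
    proof (intro sum.cong refl)
      fix i assume "i \<in> {..<r}"
      have "(\<Sum>j<r. 1/4 * (W i k * W j l) * (2 * of_bool (i = j)))
          = (\<Sum>j<r. if j = i then 1/2 * (W i k * W i l) else 0)"
        by (intro sum.cong refl) auto
      then show "(\<Sum>j<r. 1/4 * (W i k * W j l) * (2 * of_bool (i = j))) = 1/2 * (W i k * W i l)"
        using \<open>i \<in> {..<r}\<close> by simp
    qed
    also have "\<dots> = p (k, l)"
      using \<open>k < M\<close> \<open>l < M\<close> by (simp add: p_def sum_distrib_left)
    finally show "(\<Sum>n<M. p (k, n) * p (n, l)) = p (k, l)" .
  next
    have "(\<Sum>k<M. p (k, k)) = 1/2 * (\<Sum>k<M. \<Sum>i<r. W i k * W i k)"
      by (simp add: p_def sum_distrib_left)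
    also have "(\<Sum>k<M. \<Sum>i<r. W i k * W i k) = (\<Sum>i<r. \<Sum>k<M. W i k * W i k)"
      by (rule sum.swap)
    also have "1/2 * \<dots> = real r" by (simp add: W)
    finally show "(\<Sum>k<M. p (k, k)) = real r" .
  qed (auto simp: p_def split: if_splits)
  have "overlap M p x + overlap M p (\<lambda>ij. flip_off_block r ij * x ij)
      = (\<Sum>k<M. \<Sum>i<M. p (k, i) * ((1 + flip_off_block r (i, k)) * x (i, k)))"
    unfolding overlap_def sum.distrib[symmetric] by (intro sum.cong refl) (simp add: algebra_simps)
  also have "\<dots> = (\<Sum>k<m. \<Sum>i<r. 2 * p (r + k, i) * x (i, r + k))"
    unfolding M_def sum_lessThan_add by (simp add: flip_off_block_def mult_ac)
  also have "\<dots> = (\<Sum>k<m. \<Sum>i<r. Q i k * x (i, r + k))"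
  proof (intro sum.cong refl)
    fix k i assume "k \<in> {..<m}" "i \<in> {..<r}"
    then have "2 * p (r + k, i) = (\<Sum>j<r. W j (r + k) * W j i)"
      by (simp add: p_def M_def)
    also have "\<dots> = (\<Sum>j<r. if j = i then Q i k else 0)"
      using \<open>i \<in> {..<r}\<close> by (intro sum.cong refl) (auto simp: W_def)
    also have "\<dots> = Q i k" using \<open>i \<in> {..<r}\<close> by simp
    finally have "2 * p (r + k, i) = Q i k" .
    then show "2 * p (r + k, i) * x (i, r + k) = Q i k * x (i, r + k)" by simp
  qed
  also have "\<dots> = (\<Sum>i<r. \<Sum>k<m. Q i k * x (i, r + k))" by (rule sum.swap)
  finally show thesis using that p gain unfolding M_def by auto
qed

text \<open>For \<open>a < 0\<close> the projection is chosen for \<open>- x\<close> instead of \<open>x\<close>; the gain is even in \<open>x\<close>. The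
  quadratic term of the energy is dropped, being nonnegative.\<close>

lemma max_energy_block_gain:
  assumes "r \<le> m" and c: "c > 0"
  shows "2 * a\<^sup>2 * real r + 2 * \<bar>a\<bar> * block_gain r m c x
    \<le> max_energy (r + m) r (\<lambda>ij. scalar_fun a ij + x ij)
      + max_energy (r + m) r (\<lambda>ij. scalar_fun a ij + flip_off_block r ij * x ij)"
proof -
  define s where "s = (if a < 0 then -1 else 1 :: real)"
  have s: "a = \<bar>a\<bar> * s" "s * s = 1" "s = 1 \<or> s = -1" by (auto simp: s_def)
  define y where "y = (\<lambda>ij. s * x ij)"
  obtain p where p: "p \<in> projs (r + m) r" and gain: "block_gain r m c y
      \<le> overlap (r + m) p y + overlap (r + m) p (\<lambda>ij. flip_off_block r ij * y ij)"
    using overlap_block_gain[OF assms] by blast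
  have "block_gain r m c y = block_gain r m c x"
    using s(3) by (auto simp: block_gain_def y_def)
  moreover have "overlap (r + m) p (\<lambda>ij. s * f ij) = s * overlap (r + m) p f" for f
    by (simp add: overlap_def sum_distrib_left algebra_simps)
  from this[of x] this[of "\<lambda>ij. flip_off_block r ij * x ij"]
  have "overlap (r + m) p y = s * overlap (r + m) p x"
    "overlap (r + m) p (\<lambda>ij. flip_off_block r ij * y ij)
      = s * overlap (r + m) p (\<lambda>ij. flip_off_block r ij * x ij)"
    by (simp_all add: y_def algebra_simps)
  ultimately have "2 * \<bar>a\<bar> * block_gain r m c x
    \<le> 2 * \<bar>a\<bar> * (s * overlap (r + m) p x + s * overlap (r + m) p (\<lambda>ij. flip_off_block r ij * x ij))"
    using gain by (intro mult_left_mono) auto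
  also have "\<dots> = 2 * (\<bar>a\<bar> * s) * overlap (r + m) p x
      + 2 * (\<bar>a\<bar> * s) * overlap (r + m) p (\<lambda>ij. flip_off_block r ij * x ij)"
    by (simp add: algebra_simps)
  finally have 1: "2 * \<bar>a\<bar> * block_gain r m c x \<le> 2 * a * overlap (r + m) p x
      + 2 * a * overlap (r + m) p (\<lambda>ij. flip_off_block r ij * x ij)"
    unfolding s(1)[symmetric] .
  have rM: "r \<le> r + m" by simp
  have 2: "a\<^sup>2 * real r + 2 * a * overlap (r + m) p f \<le> max_energy (r + m) r (\<lambda>ij. scalar_fun a ij + f ij)" for f
    using max_energy_ge[OF rM p, of "\<lambda>ij. scalar_fun a ij + f ij"] energy_nonneg[of "r + m" p f]
    unfolding energy_shift[OF p] by linarith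
  show ?thesis
    using 1 2[of x] 2[of "\<lambda>ij. flip_off_block r ij * x ij"] by linarith
qed

section \<open>Gaussian noise and its sign symmetries\<close>

text \<open>A centred normal law is symmetric and independence determines the joint law from the marginals.\<close>

lemma (in prob_space) distr_sign_change:
  fixes X :: "'i \<Rightarrow> 'a \<Rightarrow> real" and s :: "'i \<Rightarrow> real"
  assumes ne: "I \<noteq> {}" and ind: "indep_vars (\<lambda>_. borel) X I"
    and norm: "\<And>i. i \<in> I \<Longrightarrow> distributed M lborel (X i) (normal_density 0 \<sigma>)"
    and \<sigma>: "\<sigma> > 0" and s: "\<And>i. \<bar>s i\<bar> = 1"
  shows "distr M (Pi\<^sub>M I (\<lambda>_. borel)) (\<lambda>\<omega>. \<lambda>i\<in>I. s i * X i \<omega>)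
       = distr M (Pi\<^sub>M I (\<lambda>_. borel)) (\<lambda>\<omega>. \<lambda>i\<in>I. X i \<omega>)"
proof -
  have law: "distr M borel Y = density lborel (normal_density 0 \<sigma>)"
    if "distributed M lborel Y (normal_density 0 \<sigma>)" for Y
  proof -
    have "distr M borel Y = distr M lborel Y" by (rule distr_cong) simp_all
    then show ?thesis using distributed_distr_eq_density[OF that] by simp
  qed
  have norm': "distributed M lborel (\<lambda>\<omega>. s i * X i \<omega>) (normal_density 0 \<sigma>)" if "i \<in> I" for i
    using normal_density_affine[OF norm[OF that] \<sigma>, of "s i" 0] s[of i] by force
  have ind': "indep_vars (\<lambda>_. borel) (\<lambda>i \<omega>. s i * X i \<omega>) I"
    by (rule indep_vars_compose2[OF ind]) simp
  have rv: "random_variable borel (X i)" if "i \<in> I" for i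
    using distributed_measurable[OF norm[OF that]] by simp
  then have rv': "random_variable borel (\<lambda>\<omega>. s i * X i \<omega>)" if "i \<in> I" for i
    using that by simp
  have "distr M (Pi\<^sub>M I (\<lambda>_. borel)) (\<lambda>\<omega>. \<lambda>i\<in>I. s i * X i \<omega>)
      = Pi\<^sub>M I (\<lambda>i. distr M borel (\<lambda>\<omega>. s i * X i \<omega>))"
    using indep_vars_iff_distr_eq_PiM'[OF ne, where M' = "\<lambda>_. borel" and X = "\<lambda>i \<omega>. s i * X i \<omega>"] ind' rv' by simp
  also have "\<dots> = Pi\<^sub>M I (\<lambda>i. distr M borel (X i))"
    by (intro PiM_cong refl) (simp add: law norm norm')
  also have "\<dots> = distr M (Pi\<^sub>M I (\<lambda>_. borel)) (\<lambda>\<omega>. \<lambda>i\<in>I. X i \<omega>)"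
    using indep_vars_iff_distr_eq_PiM'[OF ne, where M' = "\<lambda>_. borel" and X = X] ind rv by simp
  finally show ?thesis .
qed

lemma abs_mult_le: "\<bar>x * y\<bar> \<le> (x\<^sup>2 + y\<^sup>2) / 2" for x y :: real
  using sum_squares_bound[of "\<bar>x\<bar>" "\<bar>y\<bar>"] by (simp add: abs_mult)

lemma fourfold_bound: "\<bar>a * b * c * d\<bar> \<le> (a ^ 4 + b ^ 4 + c ^ 4 + d ^ 4) / 4" for a b c d :: real
proof -
  have "\<bar>a * b * (c * d)\<bar> \<le> ((a * b)\<^sup>2 + (c * d)\<^sup>2) / 2" by (rule abs_mult_le)
  also have "(a * b)\<^sup>2 \<le> (a ^ 4 + b ^ 4) / 2"
    using abs_mult_le[of "a\<^sup>2" "b\<^sup>2"] by (simp add: power_mult_distrib)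
  also have "(c * d)\<^sup>2 \<le> (c ^ 4 + d ^ 4) / 2"
    using abs_mult_le[of "c\<^sup>2" "d\<^sup>2"] by (simp add: power_mult_distrib)
  finally have "\<bar>a * b * (c * d)\<bar> \<le> ((a ^ 4 + b ^ 4) / 2 + (c ^ 4 + d ^ 4) / 2) / 2"
    by simp
  also have "\<dots> = (a ^ 4 + b ^ 4 + c ^ 4 + d ^ 4) / 4" by (simp add: field_simps)
  also have "a * b * (c * d) = a * b * c * d" by (simp only: mult.assoc)
  finally show ?thesis .
qed

locale gaussian_noise = prob_space P for P :: "'a measure" +
  fixes M :: nat and \<sigma> :: real and E :: "'a \<Rightarrow> real mat"
  assumes gauss: "gaussian_matrix P M \<sigma> E" and sigma_pos: "\<sigma> > 0" and dim_pos: "M > 0"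
begin

text \<open>The noise as a function with values in a topological space, so that Borel measurability of
  functions of it makes sense.\<close>

definition noise :: "'a \<Rightarrow> nat \<times> nat \<Rightarrow> real" where
  "noise \<omega> ij = (if ij \<in> {..<M} \<times> {..<M} then E \<omega> $$ ij else 0)"

lemma E_eq: "\<omega> \<in> space P \<Longrightarrow> E \<omega> = mat M M (noise \<omega>)"
  using gauss by (intro eq_matI) (auto simp: gaussian_matrix_def noise_def)

lemma noise_distributed:
  assumes "i < M" "j < M"
  shows "distributed P lborel (\<lambda>\<omega>. noise \<omega> (i, j)) (normal_density 0 \<sigma>)"
  using gauss assms by (simp add: gaussian_matrix_def noise_def)

lemma noise_measurable: "noise \<in> borel_measurable P"
proof (rule measurable_coordinatewise_then_product)
  fix ij :: "nat \<times> nat"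
  obtain i j where ij: "ij = (i, j)" by fastforce
  show "(\<lambda>\<omega>. noise \<omega> ij) \<in> borel_measurable P"
  proof (cases "i < M \<and> j < M")
    case True
    then show ?thesis using distributed_measurable[OF noise_distributed, of i j] ij by simp
  next
    case False
    then have "(\<lambda>\<omega>. noise \<omega> ij) = (\<lambda>_. 0)" using ij by (auto simp: noise_def)
    then show ?thesis by simp
  qed
qed

lemma noise_coordinate_measurable [measurable]: "(\<lambda>\<omega>. noise \<omega> ij) \<in> borel_measurable P"
  by (rule measurable_compose[OF noise_measurable borel_measurable_continuous_onI])
    (rule continuous_on_product_coordinates)

lemma integral_sign_change:
  fixes F :: "(nat \<times> nat \<Rightarrow> real) \<Rightarrow> real"
  assumes F: "F \<in> borel_measurable borel" and s: "\<And>ij. \<bar>s ij\<bar> = 1"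
  shows "(\<integral>\<omega>. F (\<lambda>ij. s ij * noise \<omega> ij) \<partial>P) = (\<integral>\<omega>. F (noise \<omega>) \<partial>P)"
proof -
  define I where "I = {..<M} \<times> {..<M}"
  define ext where "ext z ij = (if ij \<in> I then z ij else 0)" for z :: "nat \<times> nat \<Rightarrow> real" and ij
  let ?N = "Pi\<^sub>M I (\<lambda>_. borel :: real measure)"
  have ext: "ext \<in> borel_measurable ?N"
  proof (rule measurable_coordinatewise_then_product)
    fix ij show "(\<lambda>z. ext z ij) \<in> borel_measurable ?N"
      unfolding ext_def by (cases "ij \<in> I") auto
  qed
  have FE: "(\<lambda>z. F (ext z)) \<in> borel_measurable ?N" by (rule measurable_compose[OF ext F])
  have ind: "indep_vars (\<lambda>_. borel) (\<lambda>ij \<omega>. noise \<omega> ij) I"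
  proof -
    have "indep_vars (\<lambda>_. borel) (\<lambda>ij \<omega>. E \<omega> $$ ij) I"
      using gauss by (simp add: gaussian_matrix_def I_def)
    then show ?thesis by (rule indep_vars_cong[THEN iffD1, rotated -1]) (auto simp: noise_def I_def)
  qed
  have norm: "distributed P lborel (\<lambda>\<omega>. noise \<omega> ij) (normal_density 0 \<sigma>)" if "ij \<in> I" for ij
    using that noise_distributed by (auto simp: I_def)
  have ne: "I \<noteq> {}" using dim_pos by (auto simp: I_def)
  have out: "noise \<omega> ij = 0" if "ij \<notin> I" for \<omega> ij
    using that by (simp add: noise_def I_def)
  have m1: "(\<lambda>\<omega>. \<lambda>ij\<in>I. s ij * noise \<omega> ij) \<in> measurable P ?N"
    by (intro measurable_restrict) simp
  have m2: "(\<lambda>\<omega>. \<lambda>ij\<in>I. noise \<omega> ij) \<in> measurable P ?N"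
    by (intro measurable_restrict) simp
  have e1: "(\<lambda>ij. s ij * noise \<omega> ij) = ext (\<lambda>ij\<in>I. s ij * noise \<omega> ij)" for \<omega>
    by (auto simp: ext_def out)
  have e2: "noise \<omega> = ext (\<lambda>ij\<in>I. noise \<omega> ij)" for \<omega>
    by (auto simp: ext_def out)
  have "(\<integral>\<omega>. F (\<lambda>ij. s ij * noise \<omega> ij) \<partial>P) = (\<integral>\<omega>. F (ext (\<lambda>ij\<in>I. s ij * noise \<omega> ij)) \<partial>P)"
    by (intro Bochner_Integration.integral_cong refl arg_cong[where f = F] e1)
  also have "\<dots> = (\<integral>z. F (ext z) \<partial>distr P ?N (\<lambda>\<omega>. \<lambda>ij\<in>I. s ij * noise \<omega> ij))"
    by (rule integral_distr[symmetric, OF m1 FE])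
  also have "\<dots> = (\<integral>z. F (ext z) \<partial>distr P ?N (\<lambda>\<omega>. \<lambda>ij\<in>I. noise \<omega> ij))"
    by (simp only: distr_sign_change[OF ne ind norm sigma_pos s])
  also have "\<dots> = (\<integral>\<omega>. F (ext (\<lambda>ij\<in>I. noise \<omega> ij)) \<partial>P)"
    by (rule integral_distr[OF m2 FE])
  also have "\<dots> = (\<integral>\<omega>. F (noise \<omega>) \<partial>P)"
    by (intro Bochner_Integration.integral_cong refl arg_cong[where f = F] e2[symmetric])
  finally show ?thesis .
qed

lemma noise_moments:
  assumes "i < M" "j < M"
  shows noise_integrable: "integrable P (\<lambda>\<omega>. noise \<omega> (i, j))"
    and noise_mean: "(\<integral>\<omega>. noise \<omega> (i, j) \<partial>P) = 0"
    and noise_square_integrable: "integrable P (\<lambda>\<omega>. (noise \<omega> (i, j))\<^sup>2)"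
    and noise_second_moment: "(\<integral>\<omega>. (noise \<omega> (i, j))\<^sup>2 \<partial>P) = \<sigma>\<^sup>2"
    and noise_fourth_integrable: "integrable P (\<lambda>\<omega>. (noise \<omega> (i, j)) ^ 4)"
    and noise_fourth_moment: "(\<integral>\<omega>. (noise \<omega> (i, j)) ^ 4 \<partial>P) = 3 * \<sigma> ^ 4"
proof -
  note D = noise_distributed[OF assms]
  have i: "integrable P (\<lambda>\<omega>. (noise \<omega> (i, j)) ^ k)" for k
    using distributed_integrable[OF D, of "\<lambda>x. x ^ k"] integrable_normal_moment[OF sigma_pos, of 0 k]
    by simp
  show "integrable P (\<lambda>\<omega>. (noise \<omega> (i, j))\<^sup>2)" "integrable P (\<lambda>\<omega>. (noise \<omega> (i, j)) ^ 4)"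
    by (rule i)+
  show "integrable P (\<lambda>\<omega>. noise \<omega> (i, j))" using i[of 1] by simp
  show "(\<integral>\<omega>. noise \<omega> (i, j) \<partial>P) = 0"
    using distributed_integral[OF D, of "\<lambda>x. x"] integral_normal_moment_nz_1[OF sigma_pos, of 0] by simp
  have v: "(\<integral>\<omega>. (noise \<omega> (i, j)) ^ (2 * k) \<partial>P) = fact (2 * k) / ((2 / \<sigma>\<^sup>2) ^ k * fact k)" for k
    using distributed_integral[OF D, of "\<lambda>x. x ^ (2 * k)"] integral_normal_moment_even[OF sigma_pos, of 0 k]
    by simp
  show "(\<integral>\<omega>. (noise \<omega> (i, j))\<^sup>2 \<partial>P) = \<sigma>\<^sup>2"
    using v[of 1] sigma_pos by (simp add: fact_numeral)
  show "(\<integral>\<omega>. (noise \<omega> (i, j)) ^ 4 \<partial>P) = 3 * \<sigma> ^ 4"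
    using v[of 2] sigma_pos by (simp add: fact_numeral power_divide field_simps)
qed

lemma noise_product_integrable:
  assumes "i < M" "j < M" "k < M" "l < M"
  shows "integrable P (\<lambda>\<omega>. noise \<omega> (i, j) * noise \<omega> (k, l))"
proof (rule Bochner_Integration.integrable_bound)
  show "integrable P (\<lambda>\<omega>. ((noise \<omega> (i, j))\<^sup>2 + (noise \<omega> (k, l))\<^sup>2) / 2)"
    using assms by (intro integrable_divide Bochner_Integration.integrable_add noise_square_integrable)
  show "AE \<omega> in P. norm (noise \<omega> (i, j) * noise \<omega> (k, l))
      \<le> norm (((noise \<omega> (i, j))\<^sup>2 + (noise \<omega> (k, l))\<^sup>2) / 2)"
    unfolding real_norm_def by (intro AE_I2 order_trans[OF abs_mult_le abs_ge_self])
qed simp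

text \<open>Off the diagonal, reversing the sign of one of the two entries shows that the expectation equals
  its own negative.\<close>

lemma noise_covariance:
  assumes "i < M" "j < M" "k < M" "l < M"
  shows "(\<integral>\<omega>. noise \<omega> (i, j) * noise \<omega> (k, l) \<partial>P) = \<sigma>\<^sup>2 * of_bool ((i, j) = (k, l))"
proof (cases "(i, j) = (k, l)")
  case True
  then show ?thesis using noise_second_moment[OF assms(1,2)] by (simp add: power2_eq_square)
next
  case False
  define s where "s ij = (if ij = (i, j) then -1 else 1 :: real)" for ij
  have F: "(\<lambda>z::nat \<times> nat \<Rightarrow> real. z (i, j) * z (k, l)) \<in> borel_measurable borel"
    by (intro borel_measurable_continuous_onI continuous_intros continuous_on_product_coordinates)
  have "(\<integral>\<omega>. - (noise \<omega> (i, j) * noise \<omega> (k, l)) \<partial>P) = (\<integral>\<omega>. noise \<omega> (i, j) * noise \<omega> (k, l) \<partial>P)"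
    using integral_sign_change[OF F, of s] False by (auto simp: s_def)
  then show ?thesis using False by auto
qed

text \<open>The bound by the fourth moment is the inequality of arithmetic and geometric means. An entry
  that occurs only once makes the expectation vanish, again by reversing its sign.\<close>

lemma noise_fourfold:
  assumes "a \<in> {..<M} \<times> {..<M}" "b \<in> {..<M} \<times> {..<M}" "c \<in> {..<M} \<times> {..<M}" "d \<in> {..<M} \<times> {..<M}"
  shows noise_fourfold_integrable: "integrable P (\<lambda>\<omega>. noise \<omega> a * noise \<omega> b * noise \<omega> c * noise \<omega> d)"
    and noise_fourfold_le: "(\<integral>\<omega>. noise \<omega> a * noise \<omega> b * noise \<omega> c * noise \<omega> d \<partial>P) \<le> 3 * \<sigma> ^ 4"
    and noise_fourfold_eq_0: "a \<notin> {b, c, d} \<Longrightarrow> (\<integral>\<omega>. noise \<omega> a * noise \<omega> b * noise \<omega> c * noise \<omega> d \<partial>P) = 0"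
proof -
  have i4: "integrable P (\<lambda>\<omega>. noise \<omega> e ^ 4)" and m4: "(\<integral>\<omega>. noise \<omega> e ^ 4 \<partial>P) = 3 * \<sigma> ^ 4"
    if "e \<in> {..<M} \<times> {..<M}" for e
    using that noise_fourth_integrable noise_fourth_moment by auto
  let ?b = "\<lambda>\<omega>. (noise \<omega> a ^ 4 + noise \<omega> b ^ 4 + noise \<omega> c ^ 4 + noise \<omega> d ^ 4) / 4"
  have ib: "integrable P ?b"
    using assms by (intro Bochner_Integration.integrable_add integrable_divide i4)
  have bd: "\<bar>noise \<omega> a * noise \<omega> b * noise \<omega> c * noise \<omega> d\<bar> \<le> ?b \<omega>" for \<omega>
    by (rule fourfold_bound)
  show int: "integrable P (\<lambda>\<omega>. noise \<omega> a * noise \<omega> b * noise \<omega> c * noise \<omega> d)"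
  proof (rule Bochner_Integration.integrable_bound[OF ib])
    show "AE \<omega> in P. norm (noise \<omega> a * noise \<omega> b * noise \<omega> c * noise \<omega> d) \<le> norm (?b \<omega>)"
      unfolding real_norm_def by (intro AE_I2 order_trans[OF bd abs_ge_self])
  qed simp
  have "(\<integral>\<omega>. noise \<omega> a * noise \<omega> b * noise \<omega> c * noise \<omega> d \<partial>P) \<le> (\<integral>\<omega>. ?b \<omega> \<partial>P)"
    by (intro integral_mono int ib order_trans[OF abs_ge_self bd])
  also have "\<dots> = 3 * \<sigma> ^ 4"
    using assms by (simp add: i4 m4)
  finally show "(\<integral>\<omega>. noise \<omega> a * noise \<omega> b * noise \<omega> c * noise \<omega> d \<partial>P) \<le> 3 * \<sigma> ^ 4" .
  show "(\<integral>\<omega>. noise \<omega> a * noise \<omega> b * noise \<omega> c * noise \<omega> d \<partial>P) = 0" if ne: "a \<notin> {b, c, d}"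
  proof -
    define s where "s ij = (if ij = a then -1 else 1 :: real)" for ij
    have F: "(\<lambda>z::nat \<times> nat \<Rightarrow> real. z a * z b * z c * z d) \<in> borel_measurable borel"
      by (intro borel_measurable_continuous_onI continuous_intros continuous_on_product_coordinates)
    have "(\<integral>\<omega>. - (noise \<omega> a * noise \<omega> b * noise \<omega> c * noise \<omega> d) \<partial>P)
        = (\<integral>\<omega>. noise \<omega> a * noise \<omega> b * noise \<omega> c * noise \<omega> d \<partial>P)"
      using integral_sign_change[OF F, of s] ne by (auto simp: s_def)
    then show ?thesis by simp
  qed
qed

end

section \<open>The excess\<close>

context gaussian_noise
begin

lemma shifted_noise_measurable:
  "(\<lambda>\<omega>. (\<lambda>ij. c ij + s ij * noise \<omega> ij)) \<in> borel_measurable P"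
  by (rule measurable_coordinatewise_then_product) simp

lemma max_energy_integrable:
  assumes r: "r \<le> M" and s: "\<And>ij. \<bar>s ij\<bar> = 1"
  shows "integrable P (\<lambda>\<omega>. max_energy M r (\<lambda>ij. scalar_fun a ij + s ij * noise \<omega> ij))"
proof (rule Bochner_Integration.integrable_bound)
  let ?x = "\<lambda>\<omega> ij. scalar_fun a ij + s ij * noise \<omega> ij"
  let ?b = "\<lambda>\<omega>. real r * (\<Sum>i<M. \<Sum>j<M. 2 * (scalar_fun a (i, j))\<^sup>2 + 2 * (noise \<omega> (i, j))\<^sup>2)"
  show "integrable P ?b"
    by (intro integrable_mult_right Bochner_Integration.integrable_sum Bochner_Integration.integrable_add
        noise_square_integrable integrable_const) auto
  show "(\<lambda>\<omega>. max_energy M r (?x \<omega>)) \<in> borel_measurable P"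
    by (rule measurable_compose[OF shifted_noise_measurable max_energy_measurable[OF r]])
  show "AE \<omega> in P. norm (max_energy M r (?x \<omega>)) \<le> norm (?b \<omega>)"
  proof (rule AE_I2)
    fix \<omega>
    have sq: "(?x \<omega> ij)\<^sup>2 \<le> 2 * (scalar_fun a ij)\<^sup>2 + 2 * (noise \<omega> ij)\<^sup>2" for ij
    proof -
      have "(s ij * noise \<omega> ij)\<^sup>2 = (noise \<omega> ij)\<^sup>2"
        using s[of ij] by (simp add: power_mult_distrib power2_eq_1_iff abs_if split: if_splits)
      moreover have "(u + v)\<^sup>2 \<le> 2 * u\<^sup>2 + 2 * v\<^sup>2" for u v :: real
        using sum_squares_bound[of u v] by (simp add: power2_sum)
      ultimately show ?thesis by metis
    qed
    have "norm (max_energy M r (?x \<omega>)) = max_energy M r (?x \<omega>)"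
      using max_energy_bounds(1)[OF r] by simp
    also have "\<dots> \<le> real r * (\<Sum>i<M. \<Sum>j<M. (?x \<omega> (i, j))\<^sup>2)"
      by (rule max_energy_bounds(2)[OF r])
    also have "\<dots> \<le> ?b \<omega>" by (intro mult_left_mono sum_mono sq) simp
    finally show "norm (max_energy M r (?x \<omega>)) \<le> norm (?b \<omega>)" by simp
  qed
qed

lemma integral_max_energy_sign_change:
  assumes r: "r \<le> M" and s: "\<And>ij. \<bar>s ij\<bar> = 1"
  shows "(\<integral>\<omega>. max_energy M r (\<lambda>ij. scalar_fun a ij + s ij * noise \<omega> ij) \<partial>P)
       = (\<integral>\<omega>. max_energy M r (\<lambda>ij. scalar_fun a ij + noise \<omega> ij) \<partial>P)"
proof (rule integral_sign_change[where F = "\<lambda>z. max_energy M r (\<lambda>ij. scalar_fun a ij + z ij)", OF _ s])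
  have "continuous_on UNIV (\<lambda>z ij. scalar_fun a ij + z ij)"
    by (intro continuous_on_coordinatewise_then_product continuous_intros continuous_on_product_coordinates)
  then have "(\<lambda>z ij. scalar_fun a ij + z ij) \<in> borel_measurable borel"
    by (rule borel_measurable_continuous_onI)
  then show "(\<lambda>z. max_energy M r (\<lambda>ij. scalar_fun a ij + z ij)) \<in> borel_measurable borel"
    by (rule measurable_compose[OF _ max_energy_measurable[OF r]])
qed

text \<open>The covariances leave \<open>\<sigma>\<^sup>2 |p|\<^sup>2\<close> for every column of the noise, so the value depends on the rank of
  \<open>p\<close> only.\<close>

lemma integral_energy_noise:
  assumes p: "p \<in> projs M r"
  shows "integrable P (\<lambda>\<omega>. energy M p (noise \<omega>))"
    and "(\<integral>\<omega>. energy M p (noise \<omega>) \<partial>P) = \<sigma>\<^sup>2 * real M * real r"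
proof -
  let ?t = "\<lambda>i j k l \<omega>. p (i, k) * p (i, l) * (noise \<omega> (k, j) * noise \<omega> (l, j))"
  have e: "energy M p (noise \<omega>) = (\<Sum>i<M. \<Sum>j<M. \<Sum>k<M. \<Sum>l<M. ?t i j k l \<omega>)" for \<omega>
    unfolding energy_def power2_eq_square sum_product by (intro sum.cong refl) (simp only: mult_ac)
  have int: "integrable P (?t i j k l)" if "j < M" "k < M" "l < M" for i j k l
    using that by (intro integrable_mult_right noise_product_integrable)
  show "integrable P (\<lambda>\<omega>. energy M p (noise \<omega>))"
    unfolding e by (intro Bochner_Integration.integrable_sum int) auto
  have "(\<integral>\<omega>. energy M p (noise \<omega>) \<partial>P) = (\<Sum>i<M. \<Sum>j<M. \<Sum>k<M. \<Sum>l<M. (\<integral>\<omega>. ?t i j k l \<omega> \<partial>P))"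
    unfolding e
    by (intro has_bochner_integral_integral_eq has_bochner_integral_sum has_bochner_integral_integrable int) auto
  also have "\<dots> = (\<Sum>i<M. \<Sum>j<M. \<Sum>k<M. \<sigma>\<^sup>2 * (p (i, k))\<^sup>2)"
  proof (intro sum.cong refl)
    fix i j k assume ijk: "i \<in> {..<M}" "j \<in> {..<M}" "k \<in> {..<M}"
    have "(\<Sum>l<M. (\<integral>\<omega>. ?t i j k l \<omega> \<partial>P)) = (\<Sum>l<M. if l = k then \<sigma>\<^sup>2 * (p (i, k))\<^sup>2 else 0)"
      using ijk by (intro sum.cong refl) (auto simp: noise_covariance power2_eq_square)
    then show "(\<Sum>l<M. (\<integral>\<omega>. ?t i j k l \<omega> \<partial>P)) = \<sigma>\<^sup>2 * (p (i, k))\<^sup>2" using ijk by simp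
  qed
  also have "\<dots> = (\<Sum>j<M. \<Sum>i<M. \<Sum>k<M. \<sigma>\<^sup>2 * (p (i, k))\<^sup>2)" by (rule sum.swap)
  also have "\<dots> = \<sigma>\<^sup>2 * real M * real r"
    by (simp only: sum_distrib_left[symmetric] projs_sum_squares[OF p]) simp
  finally show "(\<integral>\<omega>. energy M p (noise \<omega>) \<partial>P) = \<sigma>\<^sup>2 * real M * real r" .
qed

lemma integral_energy_shifted:
  assumes p: "p \<in> projs M r"
  shows "(\<integral>\<omega>. energy M p (\<lambda>ij. scalar_fun a ij + noise \<omega> ij) \<partial>P) = a\<^sup>2 * real r + \<sigma>\<^sup>2 * real M * real r"
proof -
  have i: "integrable P (\<lambda>\<omega>. overlap M p (noise \<omega>))"
    unfolding overlap_def
    by (intro Bochner_Integration.integrable_sum integrable_mult_right noise_integrable) auto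
  have "(\<integral>\<omega>. overlap M p (noise \<omega>) \<partial>P) = (\<Sum>i<M. \<Sum>k<M. p (i, k) * (\<integral>\<omega>. noise \<omega> (k, i) \<partial>P))"
    unfolding overlap_def
    by (intro has_bochner_integral_integral_eq has_bochner_integral_sum has_bochner_integral_mult_right
        has_bochner_integral_integrable noise_integrable) auto
  then have "(\<integral>\<omega>. overlap M p (noise \<omega>) \<partial>P) = 0" by (simp add: noise_mean)
  then show ?thesis
    unfolding energy_shift[OF p] using i integral_energy_noise[OF p] by (simp add: prob_space)
qed

text \<open>The expected energy is the same for all projections of rank \<open>r\<close>, hence whichever of them is
  selected as the deterministic maximizer gives the same second term.\<close>

lemma excess_eq:
  assumes r: "r \<le> M"
  shows "excess P E M r (a \<cdot>\<^sub>m 1\<^sub>m M)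
    = (\<integral>\<omega>. max_energy M r (\<lambda>ij. scalar_fun a ij + noise \<omega> ij) \<partial>P) - a\<^sup>2 * real r - \<sigma>\<^sup>2 * real M * real r"
proof -
  let ?X = "\<lambda>\<omega>. a \<cdot>\<^sub>m 1\<^sub>m M + E \<omega>"
  let ?x = "\<lambda>\<omega> ij. scalar_fun a ij + noise \<omega> ij"
  let ?f = "\<lambda>A. \<integral>\<omega>. (hs_norm (A * ?X \<omega>))\<^sup>2 \<partial>P"
  have X: "?X \<omega> = mat M M (?x \<omega>)" if "\<omega> \<in> space P" for \<omega>
    by (intro eq_matI) (auto simp: E_eq[OF that] scalar_fun_def)
  have hat: "(\<integral>\<omega>. (hs_norm (pi_hat M r (?X \<omega>) * ?X \<omega>))\<^sup>2 \<partial>P) = (\<integral>\<omega>. max_energy M r (?x \<omega>) \<partial>P)"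
    unfolding max_energy_def by (intro Bochner_Integration.integral_cong refl) (simp only: X)
  have f: "?f (mat M M p) = a\<^sup>2 * real r + \<sigma>\<^sup>2 * real M * real r" if "p \<in> projs M r" for p
  proof -
    have "?f (mat M M p) = (\<integral>\<omega>. energy M p (?x \<omega>) \<partial>P)"
      by (intro Bochner_Integration.integral_cong refl) (simp only: X hs_norm_mult_mat)
    then show ?thesis by (simp only: integral_energy_shifted[OF that])
  qed
  have f': "?f A = a\<^sup>2 * real r + \<sigma>\<^sup>2 * real M * real r" if A: "A \<in> orth_projs M r" for A
  proof -
    obtain p where "p \<in> projs M r" "A = mat M M p"
      using A unfolding orth_projs_eq by (rule imageE)
    then show ?thesis by (simp only: f)
  qed
  obtain q where "q \<in> projs M r" using projs_nonempty[OF r] by blast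
  then have q: "mat M M q \<in> orth_projs M r" unfolding orth_projs_eq by (rule imageI)
  have "arg_max_on ?f (orth_projs M r) \<in> orth_projs M r"
    by (rule arg_max_on_attained(1)[OF q]) (simp only: f' f'[OF q])
  then have "?f (pi_det P M r ?X) = a\<^sup>2 * real r + \<sigma>\<^sup>2 * real M * real r"
    unfolding pi_det_def by (rule f')
  then show ?thesis unfolding excess_def Let_def hat by linarith
qed

text \<open>Average the reflection inequality over the noise; \<open>E\<close> and \<open>- E\<close> have the same law.\<close>

lemma excess_scalar_ge_excess_zero:
  assumes r: "r \<le> M"
  shows "excess P E M r (0\<^sub>m M M) \<le> excess P E M r (a \<cdot>\<^sub>m 1\<^sub>m M)"
proof -
  let ?G = "\<lambda>a. \<integral>\<omega>. max_energy M r (\<lambda>ij. scalar_fun a ij + noise \<omega> ij) \<partial>P"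
  let ?plus = "\<lambda>\<omega>. max_energy M r (\<lambda>ij. scalar_fun a ij + noise \<omega> ij)"
  let ?minus = "\<lambda>\<omega>. max_energy M r (\<lambda>ij. scalar_fun a ij + - noise \<omega> ij)"
  have s0: "(\<lambda>ij. scalar_fun 0 ij + x ij) = x" for x by (auto simp: scalar_fun_def)
  have ip: "integrable P (\<lambda>\<omega>. max_energy M r (\<lambda>ij. scalar_fun b ij + noise \<omega> ij))" for b
    using max_energy_integrable[OF r, of "\<lambda>_. 1" b] by simp
  have im: "integrable P ?minus" and m: "(\<integral>\<omega>. ?minus \<omega> \<partial>P) = ?G a"
    using max_energy_integrable[OF r, of "\<lambda>_. -1" a]
      integral_max_energy_sign_change[OF r, of "\<lambda>_. -1" a] by simp_all
  have i0: "integrable P (\<lambda>\<omega>. max_energy M r (noise \<omega>))" using ip[of 0] unfolding s0 .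
  have "2 * a\<^sup>2 * real r + 2 * ?G 0 = (\<integral>\<omega>. 2 * a\<^sup>2 * real r + 2 * max_energy M r (noise \<omega>) \<partial>P)"
    unfolding s0 using i0 by (simp add: prob_space)
  also have "\<dots> \<le> (\<integral>\<omega>. ?plus \<omega> + ?minus \<omega> \<partial>P)"
    using i0 ip im
    by (intro integral_mono max_energy_reflection[OF r] Bochner_Integration.integrable_add
        integrable_const integrable_mult_right)
  also have "\<dots> = 2 * ?G a" using ip im m by simp
  finally have "a\<^sup>2 * real r + ?G 0 \<le> ?G a" by simp
  moreover have "0\<^sub>m M M = (0::real) \<cdot>\<^sub>m 1\<^sub>m M" by (intro eq_matI) auto
  ultimately show ?thesis using excess_eq[OF r, of a] excess_eq[OF r, of 0] by (simp only:) simp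
qed

text \<open>Average the block inequality over the noise; reversing the signs off the block preserves the
  law.\<close>

lemma excess_ge_block_gain:
  assumes M: "M = r + m" and rm: "r \<le> m" and c: "c > 0"
    and int: "integrable P (\<lambda>\<omega>. block_gain r m c (noise \<omega>))"
  shows "\<bar>a\<bar> * (\<integral>\<omega>. block_gain r m c (noise \<omega>) \<partial>P) - \<sigma>\<^sup>2 * real M * real r
     \<le> excess P E M r (a \<cdot>\<^sub>m 1\<^sub>m M)"
proof -
  have r: "r \<le> M" using M by simp
  let ?G = "\<integral>\<omega>. max_energy M r (\<lambda>ij. scalar_fun a ij + noise \<omega> ij) \<partial>P"
  let ?L = "\<integral>\<omega>. block_gain r m c (noise \<omega>) \<partial>P"
  let ?plus = "\<lambda>\<omega>. max_energy M r (\<lambda>ij. scalar_fun a ij + noise \<omega> ij)"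
  let ?flip = "\<lambda>\<omega>. max_energy M r (\<lambda>ij. scalar_fun a ij + flip_off_block r ij * noise \<omega> ij)"
  have s: "\<bar>flip_off_block r ij\<bar> = 1" for ij by (cases ij) (simp add: flip_off_block_def)
  have ip: "integrable P ?plus" using max_energy_integrable[OF r, of "\<lambda>_. 1" a] by simp
  have ifl: "integrable P ?flip" by (rule max_energy_integrable[OF r s])
  have "2 * a\<^sup>2 * real r + 2 * \<bar>a\<bar> * ?L
      = (\<integral>\<omega>. 2 * a\<^sup>2 * real r + 2 * \<bar>a\<bar> * block_gain r m c (noise \<omega>) \<partial>P)"
    using int by (simp add: prob_space)
  also have "\<dots> \<le> (\<integral>\<omega>. ?plus \<omega> + ?flip \<omega> \<partial>P)"
    using int ip ifl max_energy_block_gain[OF rm c, folded M]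
    by (intro integral_mono Bochner_Integration.integrable_add integrable_const integrable_mult_right)
  also have "\<dots> = 2 * ?G"
    using ip ifl integral_max_energy_sign_change[OF r, of "flip_off_block r" a] s by simp
  finally show ?thesis unfolding excess_eq[OF r] by linarith
qed

text \<open>The fourth-order part is \<open>tr ((B B\<^sup>T)\<^sup>2)\<close>. Its summands have expectation zero unless the two row
  indices or the two column indices coincide, which leaves \<open>r m\<^sup>2 + r\<^sup>2 m \<le> 2 r m\<^sup>2\<close> summands of size at
  most \<open>3 \<sigma>\<^sup>4\<close>.\<close>

lemma block_gain_expectation:
  assumes M: "M = r + m" and rm: "r \<le> m" and c: "c > 0"
  shows "integrable P (\<lambda>\<omega>. block_gain r m c (noise \<omega>))"
    and "3 / (2 * c) * (real r * real m * \<sigma>\<^sup>2) - 1 / (2 * c ^ 3) * (6 * real r * (real m)\<^sup>2 * \<sigma> ^ 4)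
      \<le> (\<integral>\<omega>. block_gain r m c (noise \<omega>) \<partial>P)"
proof -
  define S where "S \<omega> = (\<Sum>j<r. \<Sum>k<m. (noise \<omega> (j, r + k))\<^sup>2)" for \<omega>
  let ?t = "\<lambda>j i k l \<omega>. noise \<omega> (i, r + k) * noise \<omega> (j, r + k) * noise \<omega> (i, r + l) * noise \<omega> (j, r + l)"
  define T where "T \<omega> = (\<Sum>j<r. \<Sum>i<r. \<Sum>k<m. \<Sum>l<m. ?t j i k l \<omega>)" for \<omega>
  have gain: "block_gain r m c (noise \<omega>) = 3 / (2 * c) * S \<omega> - 1 / (2 * c ^ 3) * T \<omega>" for \<omega>
  proof -
    have "T \<omega> = (\<Sum>j<r. \<Sum>i<r. (\<Sum>k<m. noise \<omega> (i, r + k) * noise \<omega> (j, r + k))\<^sup>2)"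
      unfolding T_def power2_eq_square sum_product by (intro sum.cong refl) (simp only: mult.assoc)
    then show ?thesis
      unfolding block_gain_def S_def by (simp only: sum_subtractf sum_distrib_left)
  qed
  have lt: "j < M" "r + k < M" if "j < r" "k < m" for j k
    using that M by auto
  have it: "integrable P (?t j i k l)" if "j < r" "i < r" "k < m" "l < m" for i j k l
    using that lt by (intro noise_fourfold_integrable) auto
  have iS: "integrable P S"
    unfolding S_def using lt by (intro Bochner_Integration.integrable_sum noise_square_integrable) auto
  have iT: "integrable P T"
    unfolding T_def by (intro Bochner_Integration.integrable_sum it) auto
  show "integrable P (\<lambda>\<omega>. block_gain r m c (noise \<omega>))"
    unfolding gain using iS iT by (intro Bochner_Integration.integrable_diff integrable_mult_right)
  have "(\<integral>\<omega>. S \<omega> \<partial>P) = (\<Sum>j<r. \<Sum>k<m. (\<integral>\<omega>. (noise \<omega> (j, r + k))\<^sup>2 \<partial>P))"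
    unfolding S_def using lt
    by (intro has_bochner_integral_integral_eq has_bochner_integral_sum has_bochner_integral_integrable
        noise_square_integrable) auto
  also have "\<dots> = real r * real m * \<sigma>\<^sup>2"
    using lt by (simp add: noise_second_moment)
  finally have ES: "(\<integral>\<omega>. S \<omega> \<partial>P) = real r * real m * \<sigma>\<^sup>2" .
  have "(\<integral>\<omega>. T \<omega> \<partial>P) = (\<Sum>j<r. \<Sum>i<r. \<Sum>k<m. \<Sum>l<m. (\<integral>\<omega>. ?t j i k l \<omega> \<partial>P))"
    unfolding T_def
    by (intro has_bochner_integral_integral_eq has_bochner_integral_sum has_bochner_integral_integrable it) auto
  also have "\<dots> \<le> (\<Sum>j<r. \<Sum>i<r. \<Sum>k<m. \<Sum>l<m. 3 * \<sigma> ^ 4 * (of_bool (i = j) + of_bool (k = l)))"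
  proof (intro sum_mono)
    fix j i k l assume *: "j \<in> {..<r}" "i \<in> {..<r}" "k \<in> {..<m}" "l \<in> {..<m}"
    have mem: "(i, r + k) \<in> {..<M} \<times> {..<M}" "(j, r + k) \<in> {..<M} \<times> {..<M}"
      "(i, r + l) \<in> {..<M} \<times> {..<M}" "(j, r + l) \<in> {..<M} \<times> {..<M}"
      using * lt by auto
    show "(\<integral>\<omega>. ?t j i k l \<omega> \<partial>P) \<le> 3 * \<sigma> ^ 4 * (of_bool (i = j) + of_bool (k = l))"
    proof (cases "i = j \<or> k = l")
      case True
      then have "3 * \<sigma> ^ 4 \<le> 3 * \<sigma> ^ 4 * (of_bool (i = j) + of_bool (k = l))"
        by (auto simp: of_bool_def)
      with noise_fourfold_le[OF mem] show ?thesis by linarith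
    next
      case False
      then show ?thesis using noise_fourfold_eq_0[OF mem] by simp
    qed
  qed
  also have "\<dots> = 3 * \<sigma> ^ 4 * (real r * (real m)\<^sup>2 + (real r)\<^sup>2 * real m)"
  proof -
    have "(\<Sum>l<n. (of_bool (k = l) :: real)) = 1" if "k < n" for k n :: nat
      using that sum.delta'[of "{..<n}" k "\<lambda>_. 1 :: real"] by (simp add: of_bool_def)
    moreover have "(\<Sum>l<n. (of_bool (l = k) :: real)) = 1" if "k < n" for k n :: nat
      using that sum.delta[of "{..<n}" k "\<lambda>_. 1 :: real"] by (simp add: of_bool_def)
    ultimately show ?thesis
      by (simp add: sum_distrib_left[symmetric] sum.distrib power2_eq_square algebra_simps)
  qed
  also have "\<dots> \<le> 3 * \<sigma> ^ 4 * (real r * (real m)\<^sup>2 + real r * (real m)\<^sup>2)"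
  proof -
    have "(real r)\<^sup>2 * real m \<le> real r * (real m)\<^sup>2"
      unfolding power2_eq_square mult.assoc using rm by (intro mult_left_mono mult_right_mono) auto
    then show ?thesis by (intro mult_left_mono) auto
  qed
  finally have ET: "(\<integral>\<omega>. T \<omega> \<partial>P) \<le> 6 * real r * (real m)\<^sup>2 * \<sigma> ^ 4" by (simp add: algebra_simps)
  have "(\<integral>\<omega>. block_gain r m c (noise \<omega>) \<partial>P) = 3 / (2 * c) * (\<integral>\<omega>. S \<omega> \<partial>P) - 1 / (2 * c ^ 3) * (\<integral>\<omega>. T \<omega> \<partial>P)"
    unfolding gain using iS iT by simp
  moreover have "1 / (2 * c ^ 3) * (\<integral>\<omega>. T \<omega> \<partial>P) \<le> 1 / (2 * c ^ 3) * (6 * real r * (real m)\<^sup>2 * \<sigma> ^ 4)"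
    using ET c by (intro mult_left_mono) auto
  ultimately show "3 / (2 * c) * (real r * real m * \<sigma>\<^sup>2) - 1 / (2 * c ^ 3) * (6 * real r * (real m)\<^sup>2 * \<sigma> ^ 4)
      \<le> (\<integral>\<omega>. block_gain r m c (noise \<omega>) \<partial>P)" unfolding ES by linarith
qed

lemma excess_linear_growth:
  assumes M: "M = r + m" and rm: "r \<le> m"
  shows "\<bar>a\<bar> * (3 / 8 * \<sigma> * real r * sqrt (real m)) - \<sigma>\<^sup>2 * real M * real r
     \<le> excess P E M r (a \<cdot>\<^sub>m 1\<^sub>m M)"
proof -
  define q where "q = sqrt (real m)"
  have "m > 0" using dim_pos M rm by linarith
  then have q: "q > 0" by (simp add: q_def)
  have mq: "real m = q\<^sup>2" by (simp add: q_def)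
  \<comment> \<open>The typical size of the singular values of the block is \<open>\<sigma> sqrt m\<close>. The factor \<open>2\<close> lets the
      second-order part, \<open>3 / 4\<close>, outweigh the fourth-order part, at most \<open>3 / 8\<close>, in units of
      \<open>\<sigma> r sqrt m\<close>.\<close>
  define c where "c = 2 * \<sigma> * q"
  have c: "c > 0" using q sigma_pos by (simp add: c_def)
  have "3 / (2 * c) * (real r * real m * \<sigma>\<^sup>2) = 3 / 4 * \<sigma> * real r * q"
    unfolding c_def mq using q sigma_pos by (simp add: field_simps power2_eq_square)
  moreover have "1 / (2 * c ^ 3) * (6 * real r * (real m)\<^sup>2 * \<sigma> ^ 4) = 3 / 8 * \<sigma> * real r * q"
    unfolding c_def mq using q sigma_pos by (simp add: field_simps power_numeral_reduce)
  ultimately have "3 / 8 * \<sigma> * real r * q \<le> (\<integral>\<omega>. block_gain r m c (noise \<omega>) \<partial>P)"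
    using block_gain_expectation(2)[OF M rm c] by linarith
  then have "\<bar>a\<bar> * (3 / 8 * \<sigma> * real r * q) \<le> \<bar>a\<bar> * (\<integral>\<omega>. block_gain r m c (noise \<omega>) \<partial>P)"
    by (intro mult_left_mono) auto
  with excess_ge_block_gain[OF M rm c block_gain_expectation(1)[OF M rm c], of a]
  show ?thesis unfolding q_def by linarith
qed

lemma excess_Liminf:
  assumes r: "r \<le> M - r" "1 \<le> r"
  shows "ereal (3 / 8 * \<sigma> * real r * sqrt (real M - real r))
    \<le> Liminf at_infinity (\<lambda>a::real. ereal (excess P E M r (a \<cdot>\<^sub>m 1\<^sub>m M) / \<bar>a\<bar>))"
proof -
  define m where "m = M - r"
  have M: "M = r + m" and rm: "r \<le> m" using r by (auto simp: m_def)
  let ?K = "3 / 8 * \<sigma> * real r * sqrt (real m)" and ?D = "\<sigma>\<^sup>2 * real M * real r"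
  have "((\<lambda>a::real. inverse (norm a)) \<longlongrightarrow> 0) at_infinity"
    by (rule tendsto_inverse_0_at_top[OF filterlim_norm_at_top])
  then have "((\<lambda>a::real. ?K - ?D * inverse \<bar>a\<bar>) \<longlongrightarrow> ?K - ?D * 0) at_infinity"
    unfolding real_norm_def by (intro tendsto_intros)
  then have "Liminf at_infinity (\<lambda>a::real. ereal (?K - ?D * inverse \<bar>a\<bar>)) = ereal ?K"
    by (intro lim_imp_Liminf) (auto simp: trivial_limit_at_infinity)
  moreover have "Liminf at_infinity (\<lambda>a::real. ereal (?K - ?D * inverse \<bar>a\<bar>))
      \<le> Liminf at_infinity (\<lambda>a::real. ereal (excess P E M r (a \<cdot>\<^sub>m 1\<^sub>m M) / \<bar>a\<bar>))"
  proof (rule Liminf_mono)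
    have "eventually (\<lambda>a::real. 1 \<le> norm a) at_infinity"
      unfolding eventually_at_infinity by blast
    then show "\<forall>\<^sub>F a in at_infinity. ereal (?K - ?D * inverse \<bar>a\<bar>)
        \<le> ereal (excess P E M r (a \<cdot>\<^sub>m 1\<^sub>m M) / \<bar>a\<bar>)"
    proof (rule eventually_mono)
      fix a :: real assume "1 \<le> norm a"
      then have "\<bar>a\<bar> > 0" by auto
      then have "?K - ?D * inverse \<bar>a\<bar> = (\<bar>a\<bar> * ?K - ?D) / \<bar>a\<bar>" by (simp add: field_simps)
      also have "\<dots> \<le> excess P E M r (a \<cdot>\<^sub>m 1\<^sub>m M) / \<bar>a\<bar>"
        using excess_linear_growth[OF M rm, of a] \<open>\<bar>a\<bar> > 0\<close> by (intro divide_right_mono) auto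
      finally show "ereal (?K - ?D * inverse \<bar>a\<bar>) \<le> ereal (excess P E M r (a \<cdot>\<^sub>m 1\<^sub>m M) / \<bar>a\<bar>)"
        by simp
    qed
  qed
  moreover have "real m = real M - real r" using M by simp
  ultimately show ?thesis by simp
qed

end

theorem theorem1p1:
  shows "(\<forall>M r (\<sigma>::real) (P::'a measure) E (\<alpha>::real).
            \<sigma> > 0 \<longrightarrow> 1 \<le> r \<longrightarrow> r \<le> M \<longrightarrow> gaussian_matrix P M \<sigma> E \<longrightarrow> \<alpha> \<noteq> 0 \<longrightarrow>
            excess P E M r (\<alpha> \<cdot>\<^sub>m 1\<^sub>m M) \<ge> excess P E M r (0\<^sub>m M M))
       \<and> (\<exists>c1::real. c1 > 0 \<and>
            (\<forall>M r (\<sigma>::real) (P::'a measure) E.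
               \<sigma> > 0 \<longrightarrow> 1 \<le> r \<longrightarrow> r \<le> M \<longrightarrow> gaussian_matrix P M \<sigma> E \<longrightarrow> r \<le> M - r \<longrightarrow>
               Liminf at_infinity (\<lambda>\<alpha>::real. ereal (excess P E M r (\<alpha> \<cdot>\<^sub>m 1\<^sub>m M) / \<bar>\<alpha>\<bar>))
                 \<ge> ereal (c1 * \<sigma> * real r * sqrt (real M - real r))))"
proof -
  have noise: "gaussian_noise P M \<sigma> E"
    if "\<sigma> > 0" "1 \<le> r" "r \<le> M" "gaussian_matrix P M \<sigma> E" for M r :: nat and \<sigma> :: real and P :: "'a measure" and E
    using that by (simp add: gaussian_noise_def gaussian_noise_axioms_def gaussian_matrix_def)
  show ?thesis
  proof (intro conjI exI[of _ "3 / 8"] allI impI)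
    show "excess P E M r (0\<^sub>m M M) \<le> excess P E M r (\<alpha> \<cdot>\<^sub>m 1\<^sub>m M)"
      if "\<sigma> > 0" "1 \<le> r" "r \<le> M" "gaussian_matrix P M \<sigma> E"
      for M r :: nat and \<sigma> :: real and P :: "'a measure" and E and \<alpha> :: real
      by (rule gaussian_noise.excess_scalar_ge_excess_zero[OF noise[OF that] that(3)])
    show "ereal (3 / 8 * \<sigma> * real r * sqrt (real M - real r))
        \<le> Liminf at_infinity (\<lambda>\<alpha>::real. ereal (excess P E M r (\<alpha> \<cdot>\<^sub>m 1\<^sub>m M) / \<bar>\<alpha>\<bar>))"
      if "\<sigma> > 0" "1 \<le> r" "r \<le> M" "gaussian_matrix P M \<sigma> E" "r \<le> M - r"
      for M r :: nat and \<sigma> :: real and P :: "'a measure" and E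
      by (rule gaussian_noise.excess_Liminf[OF noise[OF that(1-4)] that(5,2)])
  qed simp
qed

end
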